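(* For any $\alpha,\beta>0$, the distribution $\mathrm{Beta}(\alpha,\beta)$ is $\sigma_{\text{opt}}^2(\alpha,\beta)$-sub-Gaussian with optimal proxy variance $\sigma_{\text{opt}}^2(\alpha,\beta)$ given by $$\sigma_{\text{opt}}^2(\alpha,\beta)=\frac{\alpha}{(\alpha+\beta)x_0}\left(\frac{{}_1F_1(\alpha+1;\alpha+\beta+1;x_0)}{{}_1F_1(\alpha;\alpha+\beta;x_0)}-1\right),$$ where $x_0$ is the unique solution of the equation $$\ln\big({}_1F_1(\alpha;\alpha+\beta;x_0)\big)=\frac{\alpha x_0}{2(\alpha+\beta)}\left(1+\frac{{}_1F_1(\alpha+1;\alpha+\beta+1;x_0)}{{}_1F_1(\alpha;\alpha+\beta;x_0)}\right).$$ A simple and explicit upper bound to $\sigma_{\text{opt}}^2(\alpha,\beta)$ is given by $\sigma_0^2(\alpha,\beta)=\frac{1}{4(\alpha+\beta+1)}$: - for $\alpha\neq\beta$, $\mathrm{Var}[\mathrm{Beta}(\alpha,\beta)]<\sigma_{\text{opt}}^2(\alpha,\beta)<\frac{1}{4(\alpha+\beta+1)}$; - for $\alpha=\beta$, $\mathrm{Var}[\mathrm{Beta}(\alpha,\alpha)]=\sigma_{\text{opt}}^2(\alpha,\alpha)=\frac{1}{4(2\alpha+1)}$.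
   Context: A real random variable $X$ with finite mean $\mu=\mathbb{E}[X]$ is sub-Gaussian if there is a positive number $\sigma$ such that $\mathbb{E}[\exp(\lambda(X-\mu))]\le\exp(\lambda^2\sigma^2/2)$ for all $\lambda\in\mathbb{R}$. Such a constant $\sigma^2$ is called a proxy variance, and $X$ is then said to be $\sigma^2$-sub-Gaussian. The optimal proxy variance is $\sigma_{\text{opt}}^2(X)=\min\{\sigma^2\ge 0 : X \text{ is } \sigma^2\text{-sub-Gaussian}\}$. For a distribution, these notions refer to a random variable with that distribution. $\mathrm{Beta}(\alpha,\beta)$, $\alpha,\beta>0$, is the distribution on $[0,1]$ with density $f(x)=\frac{1}{B(\alpha,\beta)}x^{\alpha-1}(1-x)^{\beta-1}$, where $B(\alpha,\beta)=\frac{\Gamma(\alpha)\Gamma(\beta)}{\Gamma(\alpha+\beta)}$. Its mean is $\frac{\alpha}{\alpha+\beta}$ and its variance is $\mathrm{Var}[\mathrm{Beta}(\alpha,\beta)]=\frac{\alpha\beta}{(\alpha+\beta)^2(\alpha+\beta+1)}$. ${}_1F_1$ is the confluent hypergeometric (Kummer) function, ${}_1F_1(a;b;x)=\sum_{j=0}^\infty \frac{(a)_j}{(b)_j}\frac{x^j}{j!}$ with $(a)_j=a(a+1)\cdots(a+j-1)$, $(a)_0=1$.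
   Formalization: Since x_0 = 0 always solves the equation, "the unique solution" is read as the unique nonzero solution when α ≠ β; when α = β, 0 is the only solution and the formula for σ_opt², which is 0/0 there, is read as its limit as x_0 → 0. *)

theory Defs
  imports "HOL-Probability.Probability"
begin

text \<open>The integrability conditions express that the mean and the moment generating function are
  finite; they cannot be omitted, because the Bochner integral of a non-integrable function is 0.
  The argument \<open>v\<close> is the variance-scale constant, i.e. $\sigma^2$.\<close>

definition sub_gaussian :: "'a measure \<Rightarrow> ('a \<Rightarrow> real) \<Rightarrow> real \<Rightarrow> bool" where
  "sub_gaussian M X v \<longleftrightarrow>
     prob_space M \<and> integrable M X \<and>
     (\<forall>l::real.
        integrable M (\<lambda>\<omega>. exp (l * (X \<omega> - prob_space.expectation M X))) \<and>
        prob_space.expectation M (\<lambda>\<omega>. exp (l * (X \<omega> - prob_space.expectation M X)))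
          \<le> exp (l\<^sup>2 * v / 2))"

text \<open>The infimum is the minimum precisely when it is itself a proxy variance, that is, when
  \<open>sub_gaussian M X (optimal_proxy_variance M X)\<close> holds.\<close>

definition optimal_proxy_variance :: "'a measure \<Rightarrow> ('a \<Rightarrow> real) \<Rightarrow> real" where
  "optimal_proxy_variance M X = Inf {v. 0 \<le> v \<and> sub_gaussian M X v}"

definition beta_density :: "real \<Rightarrow> real \<Rightarrow> real \<Rightarrow> real" where
  "beta_density a b x =
     indicator {0..1} x * (x powr (a - 1) * (1 - x) powr (b - 1) / Beta a b)"

text \<open>Notions defined for a random variable \<open>X\<close> on \<open>M\<close> are applied to this distribution by
  taking \<open>X\<close> to be the identity.\<close>

definition beta_distribution :: "real \<Rightarrow> real \<Rightarrow> real measure" where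
  "beta_distribution a b = density lborel (\<lambda>x. ennreal (beta_density a b x))"

definition kummer :: "real \<Rightarrow> real \<Rightarrow> real \<Rightarrow> real" where
  "kummer a b x = (\<Sum>j. pochhammer a j / pochhammer b j * (x ^ j / fact j))"

text \<open>Both sides vanish at \<open>x = 0\<close>, so 0 is always a solution; the solution of interest for
  \<open>a \<noteq> b\<close> is the nonzero one.\<close>

definition beta_x0_equation :: "real \<Rightarrow> real \<Rightarrow> real \<Rightarrow> bool" where
  "beta_x0_equation a b x \<longleftrightarrow>
     ln (kummer a (a + b) x) =
       a * x / (2 * (a + b)) * (1 + kummer (a + 1) (a + b + 1) x / kummer a (a + b) x)"

text \<open>At \<open>x = 0\<close> this expression has a removable singularity; its HOL value there (0, from
  division by zero) is not meaningful and one has to use the limit instead.\<close>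

definition beta_proxy_formula :: "real \<Rightarrow> real \<Rightarrow> real \<Rightarrow> real" where
  "beta_proxy_formula a b x =
     a / ((a + b) * x) * (kummer (a + 1) (a + b + 1) x / kummer a (a + b) x - 1)"

definition beta_opt_variance :: "real \<Rightarrow> real \<Rightarrow> real" where
  "beta_opt_variance a b = optimal_proxy_variance (beta_distribution a b) (\<lambda>x. x)"

definition beta_variance :: "real \<Rightarrow> real \<Rightarrow> real" where
  "beta_variance a b = prob_space.variance (beta_distribution a b) (\<lambda>x. x)"

end

theory Submission
  imports Defs
begin

text \<open>
  Let \<open>K\<close> be the logarithm of the moment generating function, \<open>\<mu>\<close> the mean and
  \<open>h x = 2 (K x - \<mu> x) / x\<^sup>2\<close>, so that the optimal proxy variance is the supremum of \<open>h\<close>. One has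
  \<open>h' x = 2 G x / x\<^sup>3\<close>, where \<open>G x = x K' x + \<mu> x - 2 K x\<close> vanishes exactly at the solutions of the
  equation for \<open>x0\<close>. As \<open>G'' x = x K''' x\<close>, everything depends on the sign of the third cumulant
  \<open>K'''\<close>. Kummer's equation is a Riccati equation for \<open>u = K'\<close>, and differentiating it gives, with
  an explicit positive integrating factor \<open>I\<close>, that \<open>(I K''')'\<close> has the sign of
  \<open>1 - 2 u x - x K'' x\<close> for \<open>x > 0\<close>. If the mean is at least 1/2 this is always negative; otherwise
  it changes sign once, from positive to negative, and integrating repeatedly from \<open>0\<close> passes this
  pattern on to \<open>K'''\<close>, \<open>G'\<close> and \<open>G\<close>. Negative arguments are covered by the reflection
  \<open>t \<mapsto> 1 - t\<close>, which exchanges the two parameters. Hence \<open>h\<close> has a single maximum, at \<open>x0\<close>. The upper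
  bound comes from \<open>(x\<^sup>b (u x - \<mu>))' = x\<^sup>b u x (1 - u x) \<le> x\<^sup>b / 4\<close>, where \<open>b\<close> is the sum of the two
  parameters.
\<close>

subsection \<open>The Kummer series\<close>

definition kummer_coeff :: "real \<Rightarrow> real \<Rightarrow> nat \<Rightarrow> real" where
  "kummer_coeff a b n = pochhammer a n / pochhammer b n / fact n"

lemma kummer_altdef: "kummer a b x = (\<Sum>n. kummer_coeff a b n * x ^ n)"
  by (simp add: kummer_def kummer_coeff_def)

locale kummer_params =
  fixes a b :: real
  assumes a_pos: "0 < a" and a_less_b: "a < b"
begin

lemma b_pos: "0 < b"
  using a_pos a_less_b by linarith

lemma kummer_coeff_pos: "0 < kummer_coeff a b n"
  using a_pos b_pos by (simp add: kummer_coeff_def pochhammer_pos)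

lemma kummer_coeff_Suc: "(real n + 1) * (b + n) * kummer_coeff a b (Suc n) = (a + n) * kummer_coeff a b n"
proof -
  have "pochhammer b n > 0" "b + n > 0" using b_pos by (auto intro: pochhammer_pos simp: add_pos_nonneg)
  then show ?thesis by (simp add: kummer_coeff_def pochhammer_Suc divide_simps)
qed

lemma kummer_coeff_le: "kummer_coeff a b n \<le> 1 / fact n"
proof -
  have "pochhammer a n \<le> pochhammer b n"
    unfolding pochhammer_prod using a_pos a_less_b by (intro prod_mono) auto
  moreover have "pochhammer b n > 0" using b_pos by (rule pochhammer_pos)
  ultimately have "pochhammer a n / pochhammer b n \<le> 1" by (simp add: divide_simps)
  then show ?thesis unfolding kummer_coeff_def by (intro divide_right_mono) auto
qed

lemma summable_kummer: "summable (\<lambda>n. kummer_coeff a b n * x ^ n)"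
proof (rule summable_comparison_test')
  show "summable (\<lambda>n. inverse (fact n) * \<bar>x\<bar> ^ n)" by (rule summable_exp)
  show "norm (kummer_coeff a b n * x ^ n) \<le> inverse (fact n) * \<bar>x\<bar> ^ n" for n
  proof -
    have "norm (kummer_coeff a b n * x ^ n) = kummer_coeff a b n * \<bar>x\<bar> ^ n"
      using kummer_coeff_pos[of n] by (simp add: abs_mult power_abs)
    also have "\<dots> \<le> inverse (fact n) * \<bar>x\<bar> ^ n"
      using kummer_coeff_le[of n] by (intro mult_right_mono) (auto simp: inverse_eq_divide)
    finally show ?thesis .
  qed
qed

lemma kummer_sums: "(\<lambda>n. kummer_coeff a b n * x ^ n) sums kummer a b x"
  using summable_kummer by (simp add: kummer_altdef summable_sums)

lemma diffs_kummer_coeff: "diffs (kummer_coeff a b) n = a / b * kummer_coeff (a + 1) (b + 1) n"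
  by (simp add: diffs_def kummer_coeff_def pochhammer_rec divide_simps)

lemma shift: "kummer_params (a + 1) (b + 1)"
  using a_pos a_less_b by unfold_locales auto

text \<open>The derivative of \<open>kummer a b\<close>, written through the shifted parameters, so
  that \<open>kummer' x / kummer a b x\<close> is up to the factor \<open>a / b\<close> the ratio
  occurring in the equation for \<open>x0\<close>.\<close>

definition kummer' :: "real \<Rightarrow> real" where
  "kummer' x = a / b * kummer (a + 1) (b + 1) x"

lemma kummer'_sums: "(\<lambda>n. diffs (kummer_coeff a b) n * x ^ n) sums kummer' x"
  unfolding diffs_kummer_coeff kummer'_def mult.assoc
  by (intro sums_mult kummer_params.kummer_sums shift)

lemma DERIV_kummer: "(kummer a b has_real_derivative kummer' x) (at x)"
proof -
  have "((\<lambda>x. \<Sum>n. kummer_coeff a b n * x ^ n) has_real_derivative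
      (\<Sum>n. diffs (kummer_coeff a b) n * x ^ n)) (at x)"
    by (intro termdiffs_strong_converges_everywhere summable_kummer)
  then show ?thesis
    using sums_unique[OF kummer'_sums[of x]] by (simp add: kummer_altdef[abs_def])
qed

definition kummer'' :: "real \<Rightarrow> real" where
  "kummer'' x = a / b * kummer_params.kummer' (a + 1) (b + 1) x"

lemma DERIV_kummer': "(kummer' has_real_derivative kummer'' x) (at x)"
  unfolding kummer'_def[abs_def] kummer''_def
  by (intro DERIV_cmult kummer_params.DERIV_kummer shift)

lemma kummer''_sums: "(\<lambda>n. diffs (diffs (kummer_coeff a b)) n * x ^ n) sums kummer'' x"
proof -
  have "(\<lambda>n. a / b * (diffs (kummer_coeff (a + 1) (b + 1)) n * x ^ n)) sums kummer'' x"
    unfolding kummer''_def by (intro sums_mult kummer_params.kummer'_sums shift)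
  moreover have "a / b * (diffs (kummer_coeff (a + 1) (b + 1)) n * x ^ n)
      = diffs (diffs (kummer_coeff a b)) n * x ^ n" for n
    by (simp add: diffs_def[of "diffs _"] diffs_kummer_coeff) (simp add: diffs_def)
  ultimately show ?thesis by simp
qed

lemma kummer_0: "kummer a b 0 = 1" and kummer'_0: "kummer' 0 = a / b"
  and kummer''_0: "kummer'' 0 = a * (a + 1) / (b * (b + 1))"
proof -
  have *: "kummer a b 0 = 1" for a b
    using powser_zero[of "kummer_coeff a b"] by (simp add: kummer_altdef) (simp add: kummer_coeff_def)
  show "kummer a b 0 = 1" "kummer' 0 = a / b" by (simp_all add: * kummer'_def)
  show "kummer'' 0 = a * (a + 1) / (b * (b + 1))"
    by (simp add: kummer''_def kummer_params.kummer'_def[OF shift] *)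
qed

text \<open>The operator x d/dx multiplies the n-th coefficient by n. It is applied both to the
  Kummer coefficients and to those of the derivative.\<close>

lemma mult_powser_sums:
  fixes c :: "nat \<Rightarrow> real"
  assumes "(\<lambda>n. diffs c n * x ^ n) sums s"
  shows "(\<lambda>n. real n * c n * x ^ n) sums (x * s)"
proof -
  have "(\<lambda>n. x * (real n * c n * x ^ (n - Suc 0))) sums (x * s)"
    using assms diffs_equiv[of c x] by (intro sums_mult) (simp add: sums_iff)
  moreover have "x * (real n * c n * x ^ (n - Suc 0)) = real n * c n * x ^ n" for n
    by (cases n) auto
  ultimately show ?thesis by simp
qed

text \<open>Comparing coefficients of \<open>x ^ n\<close> reduces the differential equation to the
  two-term recurrence \<open>kummer_coeff_Suc\<close>.\<close>

lemma kummer_ode: "x * kummer'' x + (b - x) * kummer' x = a * kummer a b x"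
proof -
  let ?c = "kummer_coeff a b"
  have "(\<lambda>n. real n * diffs ?c n * x ^ n + b * (diffs ?c n * x ^ n)
      - (real n * ?c n * x ^ n + a * (?c n * x ^ n)))
      sums (x * kummer'' x + b * kummer' x - (x * kummer' x + a * kummer a b x))"
    by (intro sums_add sums_diff sums_mult mult_powser_sums kummer_sums kummer'_sums kummer''_sums)
  moreover have "real n * diffs ?c n * x ^ n + b * (diffs ?c n * x ^ n)
      - (real n * ?c n * x ^ n + a * (?c n * x ^ n)) = 0" for n
  proof -
    have "real n * diffs ?c n * x ^ n + b * (diffs ?c n * x ^ n) - (real n * ?c n * x ^ n + a * (?c n * x ^ n))
       = ((real n + 1) * (b + n) * ?c (Suc n) - (a + n) * ?c n) * x ^ n"
      by (simp add: diffs_def algebra_simps)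
    then show ?thesis by (simp only: kummer_coeff_Suc) simp
  qed
  ultimately have "x * kummer'' x + b * kummer' x - (x * kummer' x + a * kummer a b x) = 0"
    by (simp only: sums_unique2[OF _ sums_zero])
  then show ?thesis by (simp add: algebra_simps)
qed

lemma kummer_ge_1: "0 \<le> x \<Longrightarrow> 1 \<le> kummer a b x"
proof -
  assume x: "0 \<le> x"
  have "(\<Sum>n<1. kummer_coeff a b n * x ^ n) \<le> (\<Sum>n. kummer_coeff a b n * x ^ n)"
    using x by (intro sum_le_suminf summable_kummer) (auto intro!: mult_nonneg_nonneg less_imp_le[OF kummer_coeff_pos])
  then show ?thesis by (simp add: kummer_altdef kummer_coeff_def)
qed

lemma kummer_le_exp: "0 \<le> x \<Longrightarrow> kummer a b x \<le> exp x"
  unfolding kummer_altdef exp_def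
  using kummer_coeff_le summable_kummer summable_exp_generic[of x]
  by (intro suminf_le) (auto simp: mult.commute[of "x ^ _"] inverse_eq_divide[symmetric] divide_inverse intro!: mult_right_mono)

lemma kummer'_pos: "0 \<le> x \<Longrightarrow> 0 < kummer' x"
  using kummer_params.kummer_ge_1[OF shift, of x] a_pos b_pos by (simp add: kummer'_def)

text \<open>The n-th coefficient of the derivative is \<open>(a + n) / (b + n)\<close> times that of
  the series, hence no larger. The term n = 0 makes the inequality strict. This gives
  \<open>u < 1\<close> later.\<close>

lemma kummer'_less:
  assumes "0 \<le> x" shows "kummer' x < kummer a b x"
proof -
  let ?c = "kummer_coeff a b" and ?d = "\<lambda>n. kummer_coeff a b n * x ^ n - diffs (kummer_coeff a b) n * x ^ n"
  have s: "?d sums (kummer a b x - kummer' x)"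
    by (intro sums_diff kummer_sums kummer'_sums)
  have d: "diffs ?c n \<le> ?c n" for n
  proof -
    have "diffs ?c n = (a + n) / (b + n) * ?c n"
      using kummer_coeff_Suc[of n] b_pos by (simp add: diffs_def field_simps)
    also have "\<dots> \<le> 1 * ?c n"
      using a_less_b b_pos kummer_coeff_pos[of n] by (intro mult_right_mono) (auto simp: divide_simps)
    finally show ?thesis by simp
  qed
  have "0 < ?d 0" using a_less_b b_pos by (simp add: diffs_def kummer_coeff_def)
  moreover have "(\<Sum>n<1. ?d n) \<le> (\<Sum>n. ?d n)"
    using d assms by (intro sum_le_suminf sums_summable[OF s]) (auto simp: mult_right_mono)
  ultimately have "0 < (\<Sum>n. ?d n)" by simp
  then show ?thesis using s by (simp add: sums_iff)
qed

end

subsection \<open>Sign patterns under integration\<close>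

text \<open>Serves as integration from 0: a sign that the derivative has on all positive arguments
  passes to \<open>f\<close>. Only continuity is asked for at 0, because the later derivatives are
  divided by the argument.\<close>

lemma mvt_from_0:
  fixes f :: "real \<Rightarrow> real"
  assumes "0 < x" "continuous_on {0..} f" "f 0 = 0"
    and "\<And>t. 0 < t \<Longrightarrow> (f has_real_derivative f' t) (at t)"
  shows "\<exists>z. 0 < z \<and> z < x \<and> f x = x * f' z"
proof -
  have "\<exists>l z. 0 < z \<and> z < x \<and> DERIV f z :> l \<and> f x - f 0 = (x - 0) * l"
    using assms by (intro MVT) (auto intro: continuous_on_subset simp: real_differentiable_def)
  then show ?thesis using assms(3,4) by (metis DERIV_unique diff_zero)
qed

text \<open>The pattern allows zeros between the two phases and does not claim that a negative value
  occurs; that \<open>G\<close> really becomes negative is shown separately.\<close>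

definition pos_then_neg :: "(real \<Rightarrow> real) \<Rightarrow> bool" where
  "pos_then_neg g \<longleftrightarrow> (\<exists>e>0. \<forall>x. 0 < x \<longrightarrow> x \<le> e \<longrightarrow> 0 < g x) \<and>
     (\<forall>x y. 0 < x \<longrightarrow> x < y \<longrightarrow> g x < 0 \<longrightarrow> g y < 0)"

text \<open>\<open>f\<close> first rises from 0. If it is back at 0 or below at \<open>x\<close>,
  then \<open>g\<close> was negative somewhere before and stays so, hence \<open>f\<close> strictly
  decreases from \<open>x\<close> on. The weight \<open>m\<close> absorbs positive factors. The
  second conclusion also covers \<open>f x = 0\<close>, which later makes the zero of
  \<open>G\<close> unique.\<close>

lemma pos_then_neg_integrate:
  fixes f :: "real \<Rightarrow> real"
  assumes cont: "continuous_on {0..} f" and f0: "f 0 = 0"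
    and der: "\<And>t. 0 < t \<Longrightarrow> (f has_real_derivative m t * g t) (at t)"
    and m: "\<And>t. 0 < t \<Longrightarrow> 0 < m t"
    and g: "pos_then_neg g"
  shows "pos_then_neg f" and "\<And>x y. 0 < x \<Longrightarrow> x < y \<Longrightarrow> f x \<le> 0 \<Longrightarrow> f y < 0"
proof -
  obtain e where e: "e > 0" "\<And>x. 0 < x \<Longrightarrow> x \<le> e \<Longrightarrow> 0 < g x"
    using g unfolding pos_then_neg_def by blast
  have pos: "0 < f x" if x: "0 < x" "x \<le> e" for x
  proof -
    obtain z where "0 < z" "z < x" "f x = x * (m z * g z)"
      using mvt_from_0[OF x(1) cont f0 der] by blast
    then show ?thesis using e(2)[of z] m[of z] x by simp
  qed
  show strong: "f y < 0" if xy: "0 < x" "x < y" "f x \<le> 0" for x y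
  proof -
    \<comment> \<open>Otherwise \<open>f\<close> would be nondecreasing up to \<open>x\<close> and
      thus at least as large as at \<open>?w\<close>, a point chosen left of \<open>x\<close> inside
      the initial interval where \<open>f\<close> is positive.\<close>
    have "\<exists>z. 0 < z \<and> z < x \<and> g z < 0"
    proof (rule ccontr)
      assume "\<not> ?thesis"
      then have nn: "0 \<le> g z" if "0 < z" "z < x" for z using that by force
      let ?w = "min e x / 2"
      have "f ?w \<le> f x"
      proof (rule DERIV_nonneg_imp_increasing_open[of ?w x f])
        show "?w \<le> x" using e xy by auto
        show "\<exists>y. (f has_real_derivative y) (at t) \<and> 0 \<le> y" if "?w < t" "t < x" for t
        proof -
          have "0 < t" using that e xy by linarith
          then show ?thesis using der nn that m by (metis less_imp_le mult_nonneg_nonneg)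
        qed
        show "continuous_on {?w..x} f" using cont by (rule continuous_on_subset) (use e xy in auto)
      qed
      moreover have "0 < f ?w" by (rule pos) (use e xy in auto)
      ultimately show False using xy by simp
    qed
    then obtain z where z: "0 < z" "z < x" "g z < 0" by blast
    have neg: "g t < 0" if "z < t" for t using g z that unfolding pos_then_neg_def by blast
    have "f y < f x"
    proof (rule DERIV_neg_imp_decreasing[OF xy(2)])
      fix t assume "x \<le> t" "t \<le> y"
      then show "\<exists>l. (f has_real_derivative l) (at t) \<and> l < 0"
        using der[of t] m[of t] neg[of t] z by (intro exI[of _ "m t * g t"]) (auto simp: mult_pos_neg)
    qed
    then show ?thesis using xy by simp
  qed
  show "pos_then_neg f"
    unfolding pos_then_neg_def using pos e(1) strong by (meson less_imp_le)
qed

text \<open>A barrier argument: a positive excursion of \<open>f\<close> would begin at a zero with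
  slope at least 0 and end at a zero with slope at most 0, and \<open>cross\<close> excludes such a
  pair.\<close>

lemma positive_stays_positive:
  fixes f :: "real \<Rightarrow> real"
  assumes cont: "continuous_on {0..} f" and f0: "f 0 < 0"
    and der: "\<And>t. 0 < t \<Longrightarrow> (f has_real_derivative f' t) (at t)"
    and cross: "\<And>s t. 0 < s \<Longrightarrow> s < t \<Longrightarrow> f s = 0 \<Longrightarrow> f t = 0 \<Longrightarrow> 0 \<le> f' s \<Longrightarrow> 0 < f' t"
    and xy: "0 < x" "x < y" "0 < f x"
  shows "0 < f y"
proof (rule ccontr)
  assume fy: "\<not> 0 < f y"
  \<comment> \<open>\<open>s\<close> and \<open>t\<close> are the last and the first argument around
    \<open>x\<close> at which \<open>f\<close> is not positive. The first set contains 0 because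
    \<open>f 0 < 0\<close>, the second contains \<open>y\<close> by assumption.\<close>
  define s where "s = Sup {t \<in> {0..x}. f t \<le> 0}"
  define t where "t = Inf {t \<in> {x..y}. f t \<le> 0}"
  have cl: "compact {t \<in> {u..v}. f t \<le> 0}" if "0 \<le> u" for u v
  proof -
    have "closed ({u..v} \<inter> f -` {..0})"
      using that by (intro continuous_closed_preimage continuous_on_subset[OF cont]) auto
    moreover have "{u..v} \<inter> f -` {..0} = {t \<in> {u..v}. f t \<le> 0}" by auto
    ultimately show ?thesis
      by (auto simp: compact_eq_bounded_closed intro: bounded_subset[of "{u..v}"])
  qed
  have "s \<in> {t \<in> {0..x}. f t \<le> 0}" unfolding s_def
    using xy f0 cl[of 0 x]
    by (intro closed_contains_Sup compact_imp_closed bounded_imp_bdd_above compact_imp_bounded)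
       (auto intro!: exI[of _ 0])
  moreover have "f r > 0" if "s < r" "r \<le> x" for r
  proof (rule ccontr)
    assume "\<not> 0 < f r"
    then have "r \<le> s" unfolding s_def using that calculation
      by (intro cSup_upper bounded_imp_bdd_above compact_imp_bounded cl) auto
    then show False using that by simp
  qed
  ultimately have s: "0 \<le> s" "s < x" "f s \<le> 0" "\<And>r. s < r \<Longrightarrow> r \<le> x \<Longrightarrow> 0 < f r"
    using xy by (auto simp: order_le_less)
  have "t \<in> {t \<in> {x..y}. f t \<le> 0}" unfolding t_def
    using xy fy cl[of x y]
    by (intro closed_contains_Inf compact_imp_closed bounded_imp_bdd_below compact_imp_bounded)
       (auto intro!: exI[of _ y])
  moreover have "f r > 0" if "r < t" "x \<le> r" for r
  proof (rule ccontr)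
    assume "\<not> 0 < f r"
    then have "t \<le> r" unfolding t_def using that calculation xy
      by (intro cInf_lower bounded_imp_bdd_below compact_imp_bounded cl) auto
    then show False using that by simp
  qed
  ultimately have t: "x < t" "f t \<le> 0" "\<And>r. r < t \<Longrightarrow> x \<le> r \<Longrightarrow> 0 < f r"
    using xy by (auto simp: order_le_less)
  have "f s = 0"
  proof (rule ccontr)
    assume "f s \<noteq> 0"
    then have "f s < 0" using s by simp
    then have "\<exists>r\<ge>s. r \<le> x \<and> f r = 0"
      using s xy less_imp_le[OF xy(3)] by (intro IVT') (auto intro: continuous_on_subset[OF cont])
    then obtain r where r: "s \<le> r" "r \<le> x" "f r = 0" by blast
    then have "s < r" using \<open>f s < 0\<close> by (cases "r = s") auto
    then show False using s(4)[of r] r by simp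
  qed
  have "f t = 0"
  proof (rule ccontr)
    assume "f t \<noteq> 0"
    then have "f t < 0" using t by simp
    then have "\<exists>r\<ge>x. r \<le> t \<and> f r = 0"
      using t xy less_imp_le[OF xy(3)] by (intro IVT2') (auto intro: continuous_on_subset[OF cont])
    then obtain r where r: "x \<le> r" "r \<le> t" "f r = 0" by blast
    then have "r < t" using \<open>f t < 0\<close> by (cases "r = t") auto
    then show False using t(3)[of r] r by simp
  qed
  have "s > 0" using s f0 \<open>f s = 0\<close> by (cases "s = 0") auto
  \<comment> \<open>A negative slope at \<open>s\<close> would make \<open>f\<close> negative just
    right of \<open>s\<close>, where it is positive. In the same way the slope
    \<open>0 < f' t\<close> obtained from \<open>cross\<close> makes \<open>f\<close> negative just
    left of \<open>t\<close>.\<close>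
  have "0 \<le> f' s"
  proof (rule ccontr)
    assume "\<not> 0 \<le> f' s"
    then obtain d where d: "d > 0" "\<And>h. 0 < h \<Longrightarrow> h < d \<Longrightarrow> f (s + h) < f s"
      using DERIV_neg_dec_right[OF der[OF \<open>s > 0\<close>]] by (auto simp: not_le)
    obtain h where "0 < h" "h < min d (x - s)" using d(1) s(2) dense[of 0 "min d (x - s)"] by (metis diff_gt_0_iff_gt min_less_iff_conj)
    then show False using d(2)[of h] s(4)[of "s + h"] \<open>f s = 0\<close> by simp
  qed
  then have "0 < f' t" using cross[of s t] \<open>s > 0\<close> s t \<open>f s = 0\<close> \<open>f t = 0\<close> by simp
  then obtain d where d: "d > 0" "\<And>h. 0 < h \<Longrightarrow> h < d \<Longrightarrow> f (t - h) < f t"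
    using DERIV_pos_inc_left[OF der, of t] xy t by auto
  obtain h where "0 < h" "h < min d (t - x)" using d(1) t(1) dense[of 0 "min d (t - x)"] by (metis diff_gt_0_iff_gt min_less_iff_conj)
  then show False using d(2)[of h] t(3)[of "t - h"] \<open>f t = 0\<close> by simp
qed

subsection \<open>Derivatives of the cumulant generating function\<close>

context kummer_params begin

text \<open>
  With \<open>K = ln (kummer a b)\<close> these are \<open>u x = K' x\<close>, \<open>p x = x K'' x\<close> and \<open>q x = x\<^sup>2 K''' x\<close>; the
  right-hand sides of \<open>p\<close> and \<open>q\<close> result from eliminating the higher derivatives by Kummer's
  equation, and \<open>wt\<close> is the integrating factor that turns the equations for \<open>p\<close> and \<open>q\<close> into
  \<open>(wt p)' = wt u (1 - u)\<close> and \<open>(wt q)' = - 2 wt p (p - 1 + 2 u)\<close>.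
\<close>

definition u :: "real \<Rightarrow> real" where "u x = kummer' x / kummer a b x"
definition p :: "real \<Rightarrow> real" where "p x = a - b * u x + x * u x * (1 - u x)"
definition q :: "real \<Rightarrow> real" where "q x = x * u x * (1 - u x) - (b + 1) * p x + x * (1 - 2 * u x) * p x"
definition wt :: "real \<Rightarrow> real" where "wt x = x powr b * exp (- x) * (kummer a b x)\<^sup>2"

lemma kummer_pos_nonneg: "0 \<le> x \<Longrightarrow> 0 < kummer a b x"
  using kummer_ge_1 by (meson less_le_trans zero_less_one)

lemma u_0: "u 0 = a / b" and p_0: "p 0 = 0"
  using b_pos by (simp_all add: u_def p_def kummer_0 kummer'_0)

lemma u_pos: "0 \<le> x \<Longrightarrow> 0 < u x" and u_less_1: "0 \<le> x \<Longrightarrow> u x < 1"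
  using kummer_pos_nonneg kummer'_pos kummer'_less by (simp_all add: u_def)

section \<open>Differential equations for \<open>u\<close>, \<open>p\<close>, \<open>q\<close> and
  \<open>wt\<close>\<close>

lemma DERIV_u:
  assumes "0 < x" shows "(u has_real_derivative p x / x) (at x)"
proof -
  let ?F = "kummer a b x"
  have F: "?F > 0" using kummer_pos_nonneg assms by simp
  have "(u has_real_derivative (kummer'' x * ?F - kummer' x * kummer' x) / (?F * ?F)) (at x)"
    unfolding u_def[abs_def] using F by (intro DERIV_divide DERIV_kummer DERIV_kummer') auto
  also have "(kummer'' x * ?F - kummer' x * kummer' x) / (?F * ?F) = p x / x"
  proof -
    have k: "kummer'' x = (a * ?F - (b - x) * kummer' x) / x" using kummer_ode[of x] assms by (simp add: field_simps)
    show ?thesis unfolding k p_def u_def using F assms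
      by (simp add: field_simps)
  qed
  finally show ?thesis .
qed

lemma DERIV_p:
  assumes "0 < x" shows "(p has_real_derivative (p x + q x) / x) (at x)"
proof -
  have "(p has_real_derivative - (b * (p x / x)) + ((u x + x * (p x / x)) * (1 - u x) + x * u x * (- (p x / x)))) (at x)"
    unfolding p_def[abs_def]
    by (rule derivative_eq_intros DERIV_u[OF assms, unfolded p_def] refl | simp)+
  also have "- (b * (p x / x)) + ((u x + x * (p x / x)) * (1 - u x) + x * u x * (- (p x / x))) = (p x + q x) / x"
    using assms by (simp add: q_def field_simps)
  finally show ?thesis .
qed

lemma DERIV_q:
  assumes "0 < x"
  shows "(q has_real_derivative - 2 * p x * (p x - 1 + 2 * u x) - (b / x - (1 - 2 * u x)) * q x) (at x)"
proof -
  let ?u' = "p x / x" and ?p' = "(p x + q x) / x"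
  let ?D = "(u x + x * ?u') * (1 - u x) + x * u x * (- ?u') - (b + 1) * ?p'
     + (((1 - 2 * u x) + x * (- 2 * ?u')) * p x + x * (1 - 2 * u x) * ?p')"
  have q: "q = (\<lambda>x. x * u x * (1 - u x) - (b + 1) * p x + x * (1 - 2 * u x) * p x)"
    by (simp add: q_def fun_eq_iff)
  have "((\<lambda>x. x * u x * (1 - u x) - (b + 1) * p x + x * (1 - 2 * u x) * p x) has_real_derivative ?D) (at x)"
    by (rule derivative_eq_intros DERIV_u[OF assms] DERIV_p[OF assms] refl)+ (simp add: algebra_simps)
  then have "(q has_real_derivative ?D) (at x)" unfolding q[symmetric] .
  also have "x * ?u' = p x" using assms by simp
  also have "x * (- 2 * ?u') = - 2 * p x" using assms by simp
  also have "x * (1 - 2 * u x) * ?p' = (1 - 2 * u x) * (p x + q x)" using assms by simp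
  \<comment> \<open>The final fraction on the right is 0 by the definition of \<open>q\<close>.
    Adding it turns the claim into a rational identity in which \<open>q x\<close> may be treated as
    an independent variable.\<close>
  also have "(u x + p x) * (1 - u x) + x * u x * (- ?u') - (b + 1) * ?p'
      + (((1 - 2 * u x) + - 2 * p x) * p x + (1 - 2 * u x) * (p x + q x))
    = - 2 * p x * (p x - 1 + 2 * u x) - (b / x - (1 - 2 * u x)) * q x
     + (x * u x * (1 - u x) - (b + 1) * p x + x * (1 - 2 * u x) * p x - q x) / x"
    using assms by (simp add: field_simps)
  also have "\<dots> = - 2 * p x * (p x - 1 + 2 * u x) - (b / x - (1 - 2 * u x)) * q x"
    by (simp add: q_def)
  finally show ?thesis .
qed

lemma DERIV_wt:
  assumes "0 < x" shows "(wt has_real_derivative wt x * (b / x - (1 - 2 * u x))) (at x)"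
proof -
  let ?F = "kummer a b x"
  have F: "?F > 0" using kummer_pos_nonneg assms by simp
  have "(wt has_real_derivative (b * x powr (b - 1) * exp (- x) + x powr b * (- exp (- x))) * ?F\<^sup>2
      + x powr b * exp (- x) * (2 * ?F * kummer' x)) (at x)"
    unfolding wt_def[abs_def] using assms
    by (auto intro!: derivative_eq_intros DERIV_kummer)
  also have "(b * x powr (b - 1) * exp (- x) + x powr b * (- exp (- x))) * ?F\<^sup>2
      + x powr b * exp (- x) * (2 * ?F * kummer' x) = wt x * (b / x - (1 - 2 * u x))"
    using F assms by (simp add: wt_def u_def powr_diff field_simps power2_eq_square)
  finally show ?thesis .
qed

lemma wt_pos: "0 < x \<Longrightarrow> 0 < wt x"
  using kummer_pos_nonneg[of x] by (simp add: wt_def)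

lemma wt_0: "wt 0 = 0"
  by (simp add: wt_def)

lemma continuous_kummer: "continuous_on S (kummer a b)" and continuous_kummer': "continuous_on S kummer'"
  by (meson DERIV_kummer DERIV_kummer' DERIV_atLeastAtMost_imp_continuous_on DERIV_continuous_on has_field_derivative_at_within)+

lemma continuous_u: "continuous_on {0..} u"
  unfolding u_def[abs_def] using kummer_pos_nonneg
  by (intro continuous_intros continuous_kummer continuous_kummer') force

lemma continuous_p: "continuous_on {0..} p"
  unfolding p_def[abs_def] by (intro continuous_intros continuous_u)

lemma continuous_q: "continuous_on {0..} q"
  unfolding q_def[abs_def] by (intro continuous_intros continuous_u continuous_p)

lemma continuous_powr: "continuous_on {0..} (\<lambda>x. x powr b)"
  using b_pos by (intro continuous_on_powr' continuous_intros) auto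

lemma continuous_wt: "continuous_on {0..} wt"
  unfolding wt_def[abs_def] by (intro continuous_intros continuous_kummer continuous_powr)

text \<open>Strict convexity of K for positive arguments: \<open>wt * p\<close> vanishes at 0 and
  has the derivative \<open>wt * u * (1 - u)\<close>, which is positive as \<open>u\<close> lies
  strictly between 0 and 1.\<close>

lemma p_pos:
  assumes "0 < x" shows "0 < p x"
proof -
  have "((\<lambda>x. wt x * p x) has_real_derivative wt t * (u t * (1 - u t))) (at t)" if "0 < t" for t
    by (rule derivative_eq_intros DERIV_wt DERIV_p that refl)+
       (use that in \<open>simp add: q_def field_simps\<close>)
  from mvt_from_0[OF assms continuous_on_mult[OF continuous_wt continuous_p] _ this]
  obtain z where "0 < z" "wt x * p x = x * (wt z * (u z * (1 - u z)))"
    by (auto simp: wt_0)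
  then have "0 < wt x * p x" using assms wt_pos[of z] u_pos[of z] u_less_1[of z] by simp
  then show ?thesis using wt_pos[OF assms] by (simp add: zero_less_mult_iff)
qed

lemma u_strict_mono:
  assumes "0 \<le> x" "x < y" shows "u x < u y"
proof (rule DERIV_pos_imp_increasing_open[OF assms(2)])
  show "\<exists>l. (u has_real_derivative l) (at t) \<and> 0 < l" if "x < t" "t < y" for t
    using that assms DERIV_u[of t] p_pos[of t] by (intro exI[of _ "p t / t"]) auto
  show "continuous_on {x..y} u" using continuous_u by (rule continuous_on_subset) (use assms in auto)
qed

lemma DERIV_wt_q:
  assumes "0 < t"
  shows "((\<lambda>x. wt x * q x) has_real_derivative 2 * wt t * p t * - (p t - 1 + 2 * u t)) (at t)"
  by (rule derivative_eq_intros DERIV_wt DERIV_q assms refl)+ (simp add: algebra_simps)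

section \<open>The sign of \<open>G\<close>\<close>

definition G :: "real \<Rightarrow> real" where "G x = x * u x + x * (a / b) - 2 * ln (kummer a b x)"

lemma DERIV_ln_kummer: "0 \<le> x \<Longrightarrow> ((\<lambda>x. ln (kummer a b x)) has_real_derivative u x) (at x)"
  using kummer_pos_nonneg[of x] by (auto intro!: derivative_eq_intros DERIV_kummer simp: u_def)

lemma continuous_ln_kummer: "continuous_on {0..} (\<lambda>x. ln (kummer a b x))"
  using kummer_pos_nonneg by (intro continuous_intros continuous_kummer) force

lemma DERIV_G: "0 < x \<Longrightarrow> (G has_real_derivative p x - u x + a / b) (at x)"
  unfolding G_def[abs_def]
  by (rule derivative_eq_intros DERIV_u DERIV_ln_kummer refl | simp)+

lemma G_0: "G 0 = 0" by (simp add: G_def kummer_0)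

lemma DERIV_G': "0 < x \<Longrightarrow> ((\<lambda>x. p x - u x + a / b) has_real_derivative q x / x) (at x)"
  by (rule derivative_eq_intros DERIV_u DERIV_p refl | simp add: add_divide_distrib)+

lemma continuous_G: "continuous_on {0..} G"
  unfolding G_def[abs_def] by (intro continuous_intros continuous_u continuous_ln_kummer)

lemma continuous_G': "continuous_on {0..} (\<lambda>x. p x - u x + a / b)"
  by (intro continuous_intros continuous_u continuous_p)

text \<open>As \<open>u\<close> increases from \<open>a / b\<close>, which is at least 1/2, and
  \<open>p\<close> is positive, \<open>wt * q\<close> has negative derivative. Three integrations
  from 0 give negativity of \<open>q\<close>, of the derivative of \<open>G\<close>, and of
  \<open>G\<close>.\<close>

lemma G_neg:
  assumes ab: "b \<le> 2 * a" and "0 < x"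
  shows "G x < 0"
proof -
  have q: "q x < 0" if x: "0 < x" for x
  proof -
    obtain z where z: "0 < z" "wt x * q x = x * (2 * wt z * p z * - (p z - 1 + 2 * u z))"
      using mvt_from_0[OF x continuous_on_mult[OF continuous_wt continuous_q] _ DERIV_wt_q]
      by (auto simp: wt_0)
    have "1 / 2 \<le> a / b" using ab b_pos by (simp add: field_simps)
    also have "\<dots> < u z" using u_strict_mono[of 0 z] z u_0 by simp
    finally have "wt x * q x < 0" unfolding z using x z wt_pos[of z] p_pos[of z]
      by (intro mult_pos_neg) (auto intro: add_pos_pos)
    then show ?thesis using wt_pos[OF x] by (simp add: mult_less_0_iff)
  qed
  have G': "p x - u x + a / b < 0" if x: "0 < x" for x
  proof -
    obtain z where z: "0 < z" "p x - u x + a / b = x * (q z / z)"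
      using mvt_from_0[OF x continuous_G' _ DERIV_G'] u_0 p_0 by auto
    then show ?thesis using q[of z] x by (simp add: mult_pos_neg divide_neg_pos)
  qed
  obtain z where "0 < z" "G x = x * (p z - u z + a / b)"
    using mvt_from_0[OF assms(2) continuous_G G_0 DERIV_G] by auto
  then show ?thesis using G'[of z] assms by (simp add: mult_pos_neg)
qed

text \<open>\<open>?T\<close> starts at \<open>2 * a / b - 1 < 0\<close>, so by
  \<open>positive_stays_positive\<close> it is enough to compare its slopes at two zeros. There the
  slope has the sign of the cubic \<open>?c\<close>.\<close>

lemma pos_then_neg_skewness_slope:
  assumes ab: "2 * a < b"
  shows "pos_then_neg (\<lambda>x. - (p x - 1 + 2 * u x))"
proof -
  let ?T = "\<lambda>x. p x - 1 + 2 * u x"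
  let ?c = "\<lambda>x. (1 - a) * (1 - u x) ^ 3 + (b - a - 1) * u x ^ 3"
  have cont: "continuous_on {0..} ?T" by (intro continuous_intros continuous_u continuous_p)
  have T0: "?T 0 < 0" using ab b_pos by (simp add: u_0 p_0 field_simps)
  have der: "(?T has_real_derivative (q t + 3 * p t) / t) (at t)" if "0 < t" for t
    by (rule derivative_eq_intros DERIV_u DERIV_p that refl)+ (simp add: add_divide_distrib)
  \<comment> \<open>On the zero set of \<open>?T\<close> the argument \<open>t\<close> can be eliminated, and the sign of the derivative
    depends on \<open>u t\<close> alone.\<close>
  have zero: "u t * (1 - u t) * (q t + 3 * p t) = ?c t" if "?T t = 0" for t
  proof -
    have p: "p t = 1 - 2 * u t" using that by simp
    have X: "t * u t * (1 - u t) = p t - a + b * u t" by (simp add: p_def)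
    have "u t * (1 - u t) * (q t + 3 * p t) = (t * u t * (1 - u t)) * (u t * (1 - u t) + (1 - 2 * u t) * p t)
        - (b - 2) * p t * (u t * (1 - u t))" by (simp add: q_def algebra_simps)
    then show ?thesis unfolding X unfolding p by (simp add: algebra_simps power3_eq_cube)
  qed
  have sgn: "(0 \<le> (q t + 3 * p t) / t \<longleftrightarrow> 0 \<le> ?c t) \<and> (0 < (q t + 3 * p t) / t \<longleftrightarrow> 0 < ?c t)"
    if "0 < t" "?T t = 0" for t
  proof -
    define k where "k = u t * (1 - u t)"
    have "0 < k" unfolding k_def using that(1) u_pos[of t] u_less_1[of t] by simp
    then show ?thesis
      unfolding zero[OF that(2), symmetric] k_def[symmetric] using that(1)
      by (simp_all only: zero_le_mult_iff zero_less_mult_iff zero_le_divide_iff zero_less_divide_iff) auto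
  qed
  have cross: "0 < (q t + 3 * p t) / t"
    if st: "0 < s" "s < t" "?T s = 0" "?T t = 0" "0 \<le> (q s + 3 * p s) / s" for s t
  proof -
    \<comment> \<open>At a zero of \<open>?T\<close> one has \<open>p t = 1 - 2 * u t\<close>, and
      \<open>p\<close> is positive, so \<open>u t\<close> is below 1/2.\<close>
    have u: "u s < u t" "0 < u s" "u t < 1 / 2"
      using u_strict_mono[of s t] u_pos[of s] p_pos[of t] st by auto
    have "0 < ?c t"
    \<comment> \<open>For \<open>a \<le> 1\<close> the cubic equals
      \<open>(1 - a) * ((1 - u) ^ 3 - u ^ 3) + (b - 2 * a) * u ^ 3\<close>, which is positive for
      \<open>u\<close> in (0, 1/2). For \<open>a > 1\<close> both of its summands increase with
      \<open>u\<close>, so its sign at \<open>s\<close> carries over strictly to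
      \<open>t\<close>.\<close>
    proof (cases "a \<le> 1")
      case True
      have "u t ^ 3 \<le> (1 - u t) ^ 3" using u by (intro power_mono) auto
      then have "0 \<le> (1 - a) * ((1 - u t) ^ 3 - u t ^ 3)" using True by (intro mult_nonneg_nonneg) auto
      moreover have "0 < (b - 2 * a) * u t ^ 3" using ab u by simp
      ultimately show ?thesis by (simp add: algebra_simps)
    next
      case False
      have "0 \<le> ?c s" using sgn st by blast
      moreover have "(1 - a) * (1 - u s) ^ 3 \<le> (1 - a) * (1 - u t) ^ 3"
        using False u by (intro mult_left_mono_neg power_mono) auto
      moreover have "(b - a - 1) * u s ^ 3 < (b - a - 1) * u t ^ 3"
        using False u ab by (intro mult_strict_left_mono power_strict_mono) auto
      ultimately show ?thesis by linarith
    qed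
    then show ?thesis using sgn st by simp
  qed
  have "0 < ?T y" if "0 < x" "x < y" "0 < ?T x" for x y
    by (rule positive_stays_positive[where f = ?T and x = x, OF cont T0 der cross]) (use that in auto)
  then have "\<forall>x y. 0 < x \<longrightarrow> x < y \<longrightarrow> - ?T x < 0 \<longrightarrow> - ?T y < 0"
    by (simp only: neg_less_0_iff_less) blast
  moreover have "\<exists>e>0. \<forall>x. 0 < x \<longrightarrow> x \<le> e \<longrightarrow> 0 < - ?T x"
  proof -
    have "(?T \<longlongrightarrow> ?T 0) (at 0 within {0..})" using cont by (simp add: continuous_on_def)
    then have "eventually (\<lambda>x. ?T x < 0) (at 0 within {0..})" using T0 by (rule order_tendstoD)
    then obtain d where d: "d > 0" "\<And>x. x \<ge> 0 \<Longrightarrow> x \<noteq> 0 \<Longrightarrow> dist x 0 < d \<Longrightarrow> ?T x < 0"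
      by (auto simp: eventually_at)
    have "0 < - ?T x" if "0 < x" "x \<le> d / 2" for x using d(2)[of x] that d(1) by simp
    then show ?thesis using d(1) by (intro exI[of _ "d / 2"]) simp
  qed
  ultimately show ?thesis unfolding pos_then_neg_def by (intro conjI)
qed

text \<open>The sign pattern is integrated three times, with the weights \<open>2 * wt * p\<close>,
  \<open>1 / t\<close> and 1; dividing by the positive \<open>wt\<close> in between keeps
  it.\<close>

lemma G_sign_change:
  assumes ab: "2 * a < b"
  shows "pos_then_neg G" and "\<And>x y. 0 < x \<Longrightarrow> x < y \<Longrightarrow> G x \<le> 0 \<Longrightarrow> G y < 0"
proof -
  have *: "pos_then_neg (\<lambda>x. wt x * q x)"
    by (rule pos_then_neg_integrate(1)[OF continuous_on_mult[OF continuous_wt continuous_q] _ DERIV_wt_q _ pos_then_neg_skewness_slope[OF ab]])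
       (auto simp: wt_0 wt_pos p_pos)
  have "pos_then_neg q"
  proof -
    have "0 < wt x * q x \<longleftrightarrow> 0 < q x" "wt x * q x < 0 \<longleftrightarrow> q x < 0" if "0 < x" for x
      using wt_pos[OF that] by (simp_all add: mult_less_0_iff zero_less_mult_iff)
    then show ?thesis using * unfolding pos_then_neg_def by (meson less_trans)
  qed
  then have "pos_then_neg (\<lambda>x. p x - u x + a / b)"
    by (intro pos_then_neg_integrate(1)[OF continuous_G', where m = "\<lambda>t. 1 / t" and g = q])
       (use DERIV_G' in \<open>auto simp: u_0 p_0\<close>)
  then show "pos_then_neg G" "\<And>x y. 0 < x \<Longrightarrow> x < y \<Longrightarrow> G x \<le> 0 \<Longrightarrow> G y < 0"
    using pos_then_neg_integrate[OF continuous_G G_0, where m = "\<lambda>_. 1" and g = "\<lambda>x. p x - u x + a / b"] DERIV_G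
    by auto
qed

section \<open>The strict upper bound\<close>

lemma u_bound:
  assumes x: "0 < x" shows "u x - a / b < x / (4 * (b + 1))"
proof -
  let ?f = "\<lambda>x. x powr b * (u x - a / b - x / (4 * (b + 1)))"
  \<comment> \<open>The term \<open>x / (4 * (b + 1))\<close> in \<open>?f\<close> contributes
    exactly \<open>- x powr b / 4\<close>, leaving minus a square:
    \<open>- x powr b * (u x - 1 / 2)\<^sup>2\<close>.\<close>
  let ?f' = "\<lambda>x. x powr b * (u x * (1 - u x) - 1 / 4)"
  have cont: "continuous_on {0..} ?f"
    using b_pos by (intro continuous_intros continuous_u continuous_powr) auto
  have der: "(?f has_real_derivative ?f' t) (at t)" if "0 < t" for t
  proof -
    have "(?f has_real_derivative b * t powr (b - 1) * (u t - a / b - t / (4 * (b + 1)))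
        + t powr b * (p t / t - 1 / (4 * (b + 1)))) (at t)"
      using that b_pos by (auto intro!: derivative_eq_intros DERIV_u)
    also have "b * t powr (b - 1) * (u t - a / b - t / (4 * (b + 1))) + t powr b * (p t / t - 1 / (4 * (b + 1)))
        = t powr b * ((b * (u t - a / b - t / (4 * (b + 1))) + (p t - t / (4 * (b + 1)))) / t)"
    proof -
      define c d where "c = u t - a / b - t / (4 * (b + 1))" and "d = 1 / (4 * (b + 1))"
      have "t / (4 * (b + 1)) = t * d" by (simp add: d_def)
      then show ?thesis using that unfolding c_def[symmetric] d_def[symmetric]
        by (simp add: powr_diff field_simps)
    qed
    also have "(b * (u t - a / b - t / (4 * (b + 1))) + (p t - t / (4 * (b + 1)))) = t * (u t * (1 - u t) - 1 / 4)"
    proof -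
      have "b * (t / (4 * (b + 1))) + t / (4 * (b + 1)) = t / 4"
        using b_pos by (simp add: divide_simps) (simp add: algebra_simps)
      moreover have "b * (a / b) = a" using b_pos by simp
      ultimately show ?thesis by (simp add: p_def algebra_simps)
    qed
    finally show ?thesis using that by simp
  qed
  have amgm: "u t * (1 - u t) - 1 / 4 = - (u t - 1 / 2)\<^sup>2" for t
    by (simp add: power2_eq_square algebra_simps)
  \<comment> \<open>A single mean value point could have \<open>u\<close> equal to 1/2 and give only
    a weak inequality. Two points, one from each half of the interval, have different values of the
    strictly increasing \<open>u\<close>, so one of the two squares is positive.\<close>
  obtain z1 where z1: "0 < z1" "z1 < x / 2" "?f (x / 2) = x / 2 * ?f' z1"
    using mvt_from_0[OF _ cont _ der, of "x / 2"] x by auto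
  have "\<exists>l z. x / 2 < z \<and> z < x \<and> DERIV ?f z :> l \<and> ?f x - ?f (x / 2) = (x - x / 2) * l"
  proof (intro MVT continuous_on_subset[OF cont])
    show "?f differentiable (at t)" if "x / 2 < t" "t < x" for t
      using der[of t] that x unfolding real_differentiable_def by (intro exI[of _ "?f' t"]) simp
  qed (use x in auto)
  then obtain l z2 where z2: "x / 2 < z2" "z2 < x" "DERIV ?f z2 :> l" "?f x - ?f (x / 2) = (x - x / 2) * l"
    by blast
  have l: "l = ?f' z2" by (rule DERIV_unique[OF z2(3) der]) (use x z2 in linarith)
  have "u z1 \<noteq> u z2" using u_strict_mono[of z1 z2] z1 z2 by simp
  then have "u z1 \<noteq> 1 / 2 \<or> u z2 \<noteq> 1 / 2" by metis
  then have "0 < z1 powr b * (u z1 - 1 / 2)\<^sup>2 + z2 powr b * (u z2 - 1 / 2)\<^sup>2"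
    using z1 z2 x by (auto intro: add_pos_nonneg add_nonneg_pos)
  moreover have "?f x = - (x / 2 * (z1 powr b * (u z1 - 1 / 2)\<^sup>2 + z2 powr b * (u z2 - 1 / 2)\<^sup>2))"
    using z1(3) z2(4) unfolding l amgm by (simp add: algebra_simps)
  ultimately have "?f x < 0" using x by simp
  then show ?thesis using x by (simp add: mult_less_0_iff)
qed

section \<open>Bounds and derivative of \<open>h\<close>\<close>

definition h :: "real \<Rightarrow> real" where "h x = 2 * (ln (kummer a b x) - x * (a / b)) / x\<^sup>2"

lemma DERIV_centred: "0 \<le> x \<Longrightarrow> ((\<lambda>x. ln (kummer a b x) - x * (a / b)) has_real_derivative u x - a / b) (at x)"
  by (rule derivative_eq_intros DERIV_ln_kummer refl | simp)+

lemma continuous_centred: "continuous_on {0..} (\<lambda>x. ln (kummer a b x) - x * (a / b))"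
  by (intro continuous_intros continuous_ln_kummer)

lemma h_pos: assumes "0 < x" shows "0 < h x"
proof -
  obtain z where "0 < z" "ln (kummer a b x) - x * (a / b) = x * (u z - a / b)"
    using mvt_from_0[OF assms continuous_centred _ DERIV_centred] by (auto simp: kummer_0)
  then show ?thesis using u_strict_mono[of 0 z] u_0 assms by (simp add: h_def)
qed

text \<open>Integrating \<open>u_bound\<close> from 0 gives the bound
  \<open>x\<^sup>2 / (8 * (b + 1))\<close> for the centred logarithm; multiplication by
  \<open>2 / x\<^sup>2\<close> yields the stated constant.\<close>

lemma h_less_bound: assumes "0 < x" shows "h x < 1 / (4 * (b + 1))"
proof -
  let ?f = "\<lambda>x. ln (kummer a b x) - x * (a / b) - x\<^sup>2 / (8 * (b + 1))"
  have "continuous_on {0..} ?f" using b_pos by (intro continuous_intros continuous_ln_kummer) auto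
  moreover have "(?f has_real_derivative u t - a / b - t / (4 * (b + 1))) (at t)" if "0 < t" for t
  proof (rule DERIV_diff)
    show "((\<lambda>x. ln (kummer a b x) - x * (a / b)) has_real_derivative u t - a / b) (at t)"
      using that by (intro DERIV_centred) simp
    show "((\<lambda>x. x\<^sup>2 / (8 * (b + 1))) has_real_derivative t / (4 * (b + 1))) (at t)"
    proof -
      have "((\<lambda>x. x\<^sup>2 / (8 * (b + 1))) has_real_derivative (2 * t) / (8 * (b + 1))) (at t)"
        by (rule DERIV_cdivide) (auto intro!: derivative_eq_intros)
      also have "(2 * t) / (8 * (b + 1)) = t / (4 * (b + 1))" using b_pos by (simp add: divide_simps)
      finally show ?thesis .
    qed
  qed
  ultimately obtain z where "0 < z" "?f x = x * (u z - a / b - z / (4 * (b + 1)))"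
    using mvt_from_0[OF assms, of ?f "\<lambda>t. u t - a / b - t / (4 * (b + 1))"] by (auto simp: kummer_0)
  then have "?f x < 0" using u_bound[of z] assms by (simp add: mult_pos_neg)
  then have "ln (kummer a b x) - x * (a / b) < x\<^sup>2 / (8 * (b + 1))" by simp
  then show ?thesis using assms b_pos by (simp add: h_def field_simps)
qed

lemma DERIV_h:
  assumes "0 < x" shows "(h has_real_derivative 2 * G x / x ^ 3) (at x)"
proof -
  have "(h has_real_derivative (2 * (u x - a / b) * x\<^sup>2 - 2 * (ln (kummer a b x) - x * (a / b)) * (2 * x)) / (x\<^sup>2 * x\<^sup>2)) (at x)"
    unfolding h_def[abs_def] using assms
    by (intro DERIV_divide DERIV_cmult DERIV_centred) (auto intro!: derivative_eq_intros)
  also have "(2 * (u x - a / b) * x\<^sup>2 - 2 * (ln (kummer a b x) - x * (a / b)) * (2 * x)) / (x\<^sup>2 * x\<^sup>2) = 2 * G x / x ^ 3"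
    using assms b_pos by (simp add: G_def divide_simps) (simp add: algebra_simps power2_eq_square power3_eq_cube power4_eq_xxxx)
  finally show ?thesis .
qed

text \<open>The second cumulant, that is, the variance of Beta(a, b - a); see
  \<open>beta_variance_eq_var0\<close>.\<close>

definition var0 :: real where "var0 = a * (b - a) / (b\<^sup>2 * (b + 1))"

text \<open>\<open>DERIV_u\<close> does not reach 0, where its formula divides by 0, so the quotient
  rule is applied there directly. The two-sided derivative is what the limit of the proxy formula in
  the symmetric case requires.\<close>

lemma DERIV_u_0: "(u has_real_derivative var0) (at 0)"
proof -
  have "(u has_real_derivative (kummer'' 0 * kummer a b 0 - kummer' 0 * kummer' 0) / (kummer a b 0 * kummer a b 0)) (at 0)"
    unfolding u_def[abs_def] by (intro DERIV_divide DERIV_kummer DERIV_kummer') (simp add: kummer_0)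
  also have "(kummer'' 0 * kummer a b 0 - kummer' 0 * kummer' 0) / (kummer a b 0 * kummer a b 0) = var0"
    using b_pos unfolding kummer_0 kummer'_0 kummer''_0 var0_def
    by (simp add: divide_simps) (simp add: algebra_simps power2_eq_square)
  finally show ?thesis .
qed

lemma u_slope_tendsto: "((\<lambda>x. (u x - a / b) / x) \<longlongrightarrow> var0) (at 0)"
  using DERIV_u_0 by (simp add: has_field_derivative_iff u_0)

text \<open>One application of l'Hopital's rule reduces \<open>h\<close> to the difference quotient
  of \<open>u\<close> at 0.\<close>

lemma h_tendsto: "(h \<longlongrightarrow> var0) (at_right 0)"
proof -
  have ev: "\<And>P. (\<And>x. 0 < x \<Longrightarrow> P x) \<Longrightarrow> eventually P (at_right (0::real))"
    by (auto simp: eventually_at_filter)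
  have c: "((\<lambda>x. 2 * (ln (kummer a b x) - x * (a / b))) \<longlongrightarrow> 0) (at_right 0)"
  proof -
    have "((\<lambda>x. 2 * (ln (kummer a b x) - x * (a / b))) has_real_derivative 2 * (u 0 - a / b)) (at 0)"
      by (intro DERIV_cmult DERIV_centred) simp
    then have "isCont (\<lambda>x. 2 * (ln (kummer a b x) - x * (a / b))) 0" by (rule DERIV_isCont)
    then have "((\<lambda>x. 2 * (ln (kummer a b x) - x * (a / b))) \<longlongrightarrow> 0) (at 0)" by (simp add: isCont_def kummer_0)
    then show ?thesis by (rule filterlim_mono) (auto simp: at_le)
  qed
  have "((\<lambda>x. (u x - a / b) / x) \<longlongrightarrow> var0) (at_right 0)"
    using u_slope_tendsto by (rule filterlim_mono) (auto simp: at_le)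
  then have lim: "((\<lambda>x. 2 * (u x - a / b) / (2 * x)) \<longlongrightarrow> var0) (at_right 0)"
    by (subst mult_divide_mult_cancel_left) auto
  have "((\<lambda>x. 2 * (ln (kummer a b x) - x * (a / b)) / x\<^sup>2) \<longlongrightarrow> var0) (at_right 0)"
  proof (rule lhopital_right_0[OF c _ _ _ _ _ lim])
    show "((\<lambda>x. x\<^sup>2) \<longlongrightarrow> 0) (at_right (0::real))" by (auto intro!: tendsto_eq_intros)
    show "eventually (\<lambda>x. ((\<lambda>x. x\<^sup>2) has_real_derivative 2 * x) (at x)) (at_right 0)"
      by (intro ev) (auto intro!: derivative_eq_intros)
    show "eventually (\<lambda>x. ((\<lambda>x. 2 * (ln (kummer a b x) - x * (a / b))) has_real_derivative
        2 * (u x - a / b)) (at x)) (at_right 0)"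
      by (intro ev DERIV_cmult DERIV_centred) simp
  qed (auto intro: ev)
  then show ?thesis by (simp add: h_def[abs_def])
qed

text \<open>As \<open>G\<close> is negative, \<open>h\<close> decreases, so its limit at 0 from the
  right is an upper bound.\<close>

lemma h_le_var0:
  assumes ab: "b \<le> 2 * a" and x: "0 < x" shows "h x \<le> var0"
proof (rule tendsto_lowerbound[OF h_tendsto])
  have "h x \<le> h y" if "0 < y" "y < x" for y
  proof (rule less_imp_le, rule DERIV_neg_imp_decreasing[OF that(2)])
    show "\<exists>l. (h has_real_derivative l) (at t) \<and> l < 0" if "y \<le> t" for t
      using that \<open>0 < y\<close> DERIV_h[of t] G_neg[OF ab, of t]
      by (intro exI[of _ "2 * G t / t ^ 3"]) (auto intro: divide_neg_pos)
  qed
  then show "eventually (\<lambda>y. h x \<le> h y) (at_right 0)"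
    using x by (auto simp: eventually_at_right)
qed simp

lemma h_unique_maximum:
  assumes ab: "2 * a < b"
  obtains x0 where "0 < x0" "G x0 = 0" "\<And>x. 0 < x \<Longrightarrow> G x = 0 \<Longrightarrow> x = x0"
    "\<And>x. 0 < x \<Longrightarrow> h x \<le> h x0" "var0 < h x0"
proof -
  note G = G_sign_change[OF ab]
  obtain e where e: "0 < e" "0 < G e" using G(1) unfolding pos_then_neg_def by blast
  \<comment> \<open>If \<open>G\<close> were never negative, \<open>h\<close> would be nondecreasing
    and stay above \<open>h 1 > 0\<close>. But the Kummer function is at most the exponential, so
    \<open>h y\<close> is at most \<open>2 / y\<close>; at \<open>?y\<close> below this is at most
    \<open>h 1 / 2\<close>.\<close>
  have "\<exists>y>0. G y < 0"
  proof (rule ccontr)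
    assume "\<not> ?thesis"
    then have nn: "0 \<le> G y" if "0 < y" for y using that by force
    have mono: "h 1 \<le> h y" if "1 \<le> y" for y
    proof (rule DERIV_nonneg_imp_nondecreasing[OF that])
      show "\<exists>l. (h has_real_derivative l) (at t) \<and> 0 \<le> l" if "1 \<le> t" for t
        using that DERIV_h[of t] nn[of t] by (intro exI[of _ "2 * G t / t ^ 3"]) auto
    qed
    have upper: "h y \<le> 2 / y" if y: "0 < y" for y
    proof -
      have "ln (kummer a b y) \<le> y"
        using kummer_le_exp[of y] kummer_pos_nonneg[of y] y by (metis ln_exp ln_mono exp_gt_zero less_imp_le)
      moreover have "0 \<le> y * (a / b)" using y a_pos b_pos by simp
      ultimately have "h y \<le> 2 * y / y\<^sup>2" unfolding h_def using y by (intro divide_right_mono) auto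
      then show ?thesis using y by (simp add: power2_eq_square)
    qed
    let ?y = "max 1 (4 / h 1)"
    have h1: "0 < h 1" by (rule h_pos) simp
    have "h 1 \<le> 2 / ?y" using mono[of ?y] upper[of ?y] by (meson less_le_trans max.cobounded1 order_trans zero_less_one)
    also have "\<dots> \<le> 2 / (4 / h 1)" using h1 by (intro divide_left_mono) auto
    finally show False using h1 by simp
  qed
  then obtain y where y: "0 < y" "G y < 0" by blast
  have "e < y"
    using G(2)[OF y(1), of e] e y by (cases e y rule: linorder_cases) auto
  then have "\<exists>x\<ge>e. x \<le> y \<and> G x = 0"
    using e y by (intro IVT2' continuous_on_subset[OF continuous_G]) auto
  then obtain x0 where x0: "e \<le> x0" "G x0 = 0" by blast
  then have x0_pos: "0 < x0" using e by simp
  have pos: "0 < G x" if "0 < x" "x < x0" for x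
    using G(2)[OF that] x0 by force
  have neg: "G x < 0" if "x0 < x" for x
    using G(2)[OF x0_pos that] x0 by simp
  have up: "h x < h y" if "0 < x" "x < y" "y \<le> x0" for x y
  proof (rule DERIV_pos_imp_increasing_open[OF that(2)])
    show "\<exists>l. (h has_real_derivative l) (at t) \<and> 0 < l" if "x < t" "t < y" for t
      using that \<open>0 < x\<close> \<open>y \<le> x0\<close> DERIV_h[of t] pos[of t] by (intro exI[of _ "2 * G t / t ^ 3"]) auto
    show "continuous_on {x..y} h" using that(1)
      by (intro continuous_at_imp_continuous_on ballI DERIV_isCont[OF DERIV_h]) auto
  qed
  have down: "h x < h x0" if "x0 < x" for x
  proof (rule DERIV_neg_imp_decreasing_open[OF that])
    show "\<exists>l. (h has_real_derivative l) (at t) \<and> l < 0" if "x0 < t" "t < x" for t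
      using that x0_pos DERIV_h[of t] neg[of t] by (intro exI[of _ "2 * G t / t ^ 3"]) (auto intro: divide_neg_pos)
    show "continuous_on {x0..x} h" using x0_pos
      by (intro continuous_at_imp_continuous_on ballI DERIV_isCont[OF DERIV_h]) auto
  qed
  \<comment> \<open>The limit at 0 yields only a weak inequality; the intermediate point
    \<open>x0 / 2\<close> makes the comparison with \<open>h x0\<close> strict.\<close>
  have "var0 \<le> h (x0 / 2)"
  proof (rule tendsto_upperbound[OF h_tendsto])
    have "h y \<le> h (x0 / 2)" if "0 < y" "y < x0 / 2" for y
      using up[of y "x0 / 2"] that by simp
    then show "eventually (\<lambda>y. h y \<le> h (x0 / 2)) (at_right 0)"
      using x0_pos by (auto simp: eventually_at_right intro!: exI[of _ "x0 / 2"])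
  qed simp
  also have "\<dots> < h x0" using up[of "x0 / 2" x0] x0_pos by simp
  finally have v: "var0 < h x0" .
  have m: "h x \<le> h x0" if "0 < x" for x
    using up[OF that, of x0] down[of x] by (cases x x0 rule: linorder_cases) auto
  show thesis
    by (rule that[OF x0_pos x0(2) _ m v]) (use pos neg in \<open>metis less_irrefl linorder_neqE\<close>)
qed

text \<open>At a zero of \<open>G\<close> the logarithm can be eliminated from \<open>h\<close>, and
  what remains is the proxy formula.\<close>

lemma h_at_zero_G:
  assumes "x \<noteq> 0" "G x = 0" shows "h x = (u x - a / b) / x"
proof -
  have "2 * (ln (kummer a b x) - x * (a / b)) = x * (u x - a / b)"
    using assms(2) by (simp add: G_def algebra_simps)
  then show ?thesis using assms(1) by (simp add: h_def power2_eq_square)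
qed

end

subsection \<open>Moments of the beta distribution\<close>

lemma beta_density_nonneg:
  assumes "0 < \<alpha>" "0 < \<beta>" shows "0 \<le> beta_density \<alpha> \<beta> x"
  using assms by (auto simp: beta_density_def Beta_def intro!: mult_nonneg_nonneg divide_nonneg_nonneg Gamma_real_nonneg)

lemma beta_density_measurable [measurable]: "beta_density \<alpha> \<beta> \<in> borel_measurable borel"
  unfolding beta_density_def[abs_def] by measurable

lemma Beta_add_nat:
  fixes \<alpha> \<beta> :: real assumes "0 < \<alpha>" "0 < \<beta>"
  shows "Beta (\<alpha> + real n) \<beta> = pochhammer \<alpha> n / pochhammer (\<alpha> + \<beta>) n * Beta \<alpha> \<beta>"
proof (induction n)
  case (Suc n)
  have pos: "0 < \<alpha> + n" "0 < \<alpha> + \<beta> + n" using assms by auto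
  have "(\<alpha> + n + \<beta>) * Beta (\<alpha> + n + 1) \<beta> = (\<alpha> + n) * Beta (\<alpha> + n) \<beta>"
    using pos by (intro Beta_plus1_left) (auto dest: nonpos_Ints_nonpos)
  then have "Beta (\<alpha> + real (Suc n)) \<beta> = (\<alpha> + n) / (\<alpha> + \<beta> + n) * Beta (\<alpha> + n) \<beta>"
    using pos by (simp add: field_simps)
  then show ?case unfolding Suc.IH by (simp add: pochhammer_Suc mult_ac)
qed simp

text \<open>The factor \<open>x ^ n\<close> turns the integrand into that of the Beta integral with
  first parameter raised by n, and \<open>Beta_add_nat\<close> evaluates the quotient.\<close>

lemma has_bochner_integral_beta_moment:
  fixes \<alpha> \<beta> :: real assumes ab: "0 < \<alpha>" "0 < \<beta>"
  shows "has_bochner_integral lborel (\<lambda>x. beta_density \<alpha> \<beta> x * x ^ n)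
     (pochhammer \<alpha> n / pochhammer (\<alpha> + \<beta>) n)"
proof -
  let ?f = "\<lambda>x. x powr (\<alpha> + n - 1) * (1 - x) powr (\<beta> - 1) :: real"
  have int: "set_integrable lborel {0..1} ?f"
    using integrable_Beta[of "\<alpha> + n" \<beta>] ab by simp
  have "(LINT x:{0..1}|lborel. ?f x) = Beta (\<alpha> + n) \<beta>"
    using set_borel_integral_eq_integral(2)[OF int] has_integral_Beta_real[of "\<alpha> + n" \<beta>] ab
    by (simp add: has_integral_iff)
  with int have "has_bochner_integral lborel (\<lambda>x. indicator {0..1} x *\<^sub>R ?f x) (Beta (\<alpha> + n) \<beta>)"
    unfolding set_integrable_def set_lebesgue_integral_def has_bochner_integral_iff by simp
  then have "has_bochner_integral lborel (\<lambda>x. (indicator {0..1} x *\<^sub>R ?f x) / Beta \<alpha> \<beta>) (Beta (\<alpha> + n) \<beta> / Beta \<alpha> \<beta>)"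
    by (rule has_bochner_integral_divide_zero)
  also have "Beta (\<alpha> + n) \<beta> / Beta \<alpha> \<beta> = pochhammer \<alpha> n / pochhammer (\<alpha> + \<beta>) n"
  proof -
    have "Beta \<alpha> \<beta> > 0" using ab by (simp add: Beta_def Gamma_real_pos)
    then show ?thesis unfolding Beta_add_nat[OF ab] by simp
  qed
  also have "(\<lambda>x. (indicator {0..1} x *\<^sub>R ?f x) / Beta \<alpha> \<beta>) = (\<lambda>x. beta_density \<alpha> \<beta> x * x ^ n)"
  proof
    fix x :: real
    have "x powr (\<alpha> + n - 1) = x powr (\<alpha> - 1) * x ^ n" if "x > 0"
    proof -
      have "x powr (\<alpha> + n - 1) = x powr ((\<alpha> - 1) + n)" by (simp add: algebra_simps)
      then show ?thesis using that by (simp only: powr_add powr_realpow)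
    qed
    \<comment> \<open>At 0 both sides are 0, since \<open>0 powr _\<close> is 0 whatever the
      exponent.\<close>
    then show "(indicator {0..1} x *\<^sub>R ?f x) / Beta \<alpha> \<beta> = beta_density \<alpha> \<beta> x * x ^ n"
      by (cases "x = 0") (auto simp: beta_density_def indicator_def)
  qed
  finally show ?thesis .
qed

text \<open>The exponential series is integrated term by term. The integrals of the norms are the
  terms of the Kummer series at \<open>\<bar>l\<bar>\<close>, whose summability justifies the
  interchange.\<close>

lemma has_bochner_integral_beta_mgf_lborel:
  assumes ab: "0 < \<alpha>" "0 < \<beta>"
  shows "has_bochner_integral lborel (\<lambda>x. beta_density \<alpha> \<beta> x * exp (l * x)) (kummer \<alpha> (\<alpha> + \<beta>) l)"
proof -
  interpret kummer_params \<alpha> "\<alpha> + \<beta>" using ab by unfold_locales auto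
  let ?f = "\<lambda>n x. beta_density \<alpha> \<beta> x * x ^ n * (l ^ n / fact n)"
  have hb: "has_bochner_integral lborel (?f n) (kummer_coeff \<alpha> (\<alpha> + \<beta>) n * l ^ n)" for n
    using has_bochner_integral_mult_left[OF has_bochner_integral_beta_moment[OF ab, of n], of "l ^ n / fact n"]
    by (simp add: kummer_coeff_def)
  have exp_sums: "(\<lambda>n. ?f n x) sums (beta_density \<alpha> \<beta> x * exp (l * x))" for x
    using sums_mult[OF exp_converges[of "l * x"], of "beta_density \<alpha> \<beta> x"]
    by (simp add: power_mult_distrib scaleR_conv_of_real field_simps)
  have norm: "(\<integral>x. norm (?f n x) \<partial>lborel) = kummer_coeff \<alpha> (\<alpha> + \<beta>) n * \<bar>l\<bar> ^ n" for n
  proof -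
    \<comment> \<open>The density is supported in [0, 1], where \<open>x ^ n\<close> is nonnegative,
      so the absolute value affects only \<open>l\<close>.\<close>
    have "norm (?f n x) = beta_density \<alpha> \<beta> x * x ^ n * (\<bar>l\<bar> ^ n / fact n)" for x
    proof (cases "x \<in> {0..1}")
      case True
      then show ?thesis using beta_density_nonneg[OF ab, of x] by (simp add: abs_mult power_abs)
    qed (auto simp: beta_density_def)
    then show ?thesis
      using has_bochner_integral_mult_left[OF has_bochner_integral_beta_moment[OF ab, of n], of "\<bar>l\<bar> ^ n / fact n"]
      by (simp add: kummer_coeff_def has_bochner_integral_iff)
  qed
  have int: "integrable lborel (?f n)" for n using hb has_bochner_integral_iff by blast
  have ae: "AE x in lborel. summable (\<lambda>n. norm (?f n x))"
  proof (rule AE_I2)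
    fix x
    have "summable (\<lambda>n. \<bar>beta_density \<alpha> \<beta> x\<bar> * (inverse (fact n) * (\<bar>l * x\<bar>) ^ n))"
      by (intro summable_mult summable_exp)
    then show "summable (\<lambda>n. norm (?f n x))"
      by (simp add: abs_mult power_abs power_mult_distrib field_simps)
  qed
  have sn: "summable (\<lambda>n. \<integral>x. norm (?f n x) \<partial>lborel)" unfolding norm by (rule summable_kummer)
  have eq: "(\<lambda>x. \<Sum>n. ?f n x) = (\<lambda>x. beta_density \<alpha> \<beta> x * exp (l * x))"
    using exp_sums by (simp add: sums_iff)
  have "integrable lborel (\<lambda>x. beta_density \<alpha> \<beta> x * exp (l * x))"
    using integrable_suminf[OF int ae sn] unfolding eq .
  moreover have "(\<lambda>n. kummer_coeff \<alpha> (\<alpha> + \<beta>) n * l ^ n) sums (\<integral>x. beta_density \<alpha> \<beta> x * exp (l * x) \<partial>lborel)"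
    using sums_integral[OF int ae sn] hb unfolding eq has_bochner_integral_iff by simp
  ultimately show ?thesis
    using kummer_sums[of l] sums_unique2 by (auto simp: has_bochner_integral_iff)
qed

lemma has_bochner_integral_beta_distribution:
  assumes ab: "0 < \<alpha>" "0 < \<beta>" and [measurable]: "f \<in> borel_measurable borel"
    and "has_bochner_integral lborel (\<lambda>x. beta_density \<alpha> \<beta> x * f x) (c::real)"
  shows "has_bochner_integral (beta_distribution \<alpha> \<beta>) f c"
  unfolding beta_distribution_def using assms
  by (intro has_bochner_integral_density) (auto simp: beta_density_nonneg)

lemma prob_space_beta_distribution:
  assumes ab: "0 < \<alpha>" "0 < \<beta>" shows "prob_space (beta_distribution \<alpha> \<beta>)"
proof
  have "(\<integral>\<^sup>+x. ennreal (beta_density \<alpha> \<beta> x) \<partial>lborel) = 1"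
    using has_bochner_integral_beta_moment[OF ab, of 0] beta_density_nonneg[OF ab]
    by (simp add: has_bochner_integral_iff nn_integral_eq_integral)
  then show "emeasure (beta_distribution \<alpha> \<beta>) (space (beta_distribution \<alpha> \<beta>)) = 1"
    by (simp add: beta_distribution_def emeasure_density)
qed

text \<open>The second part is Kummer's transformation, read off the integral by substituting 1 - t
  for t. It yields positivity at negative arguments from the positive series at the opposite
  argument, so that logarithms make sense on the whole line.\<close>

lemma kummer_pos: assumes "0 < a" "a < b" shows "0 < kummer a b x"
  and kummer_uminus: "kummer a b (- x) = exp (- x) * kummer (b - a) b x"
proof -
  have refl: "kummer a b (- x) = exp (- x) * kummer (b - a) b x" if "0 < a" "a < b" for a b x
  proof -
    have ab: "0 < a" "0 < b - a" using that by auto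
    have i: "has_bochner_integral lborel (\<lambda>t. beta_density a (b - a) t * exp (- x * t)) (kummer a b (- x))"
      using has_bochner_integral_beta_mgf_lborel[OF ab, of "- x"] by simp
    have "has_bochner_integral lborel (\<lambda>t. beta_density (b - a) a t * exp (x * t) * exp (- x)) (kummer (b - a) b x * exp (- x))"
      using has_bochner_integral_beta_mgf_lborel[OF ab(2,1), of x] by (intro has_bochner_integral_mult_left) auto
    moreover have "beta_density a (b - a) (1 + - 1 * t) * exp (- x * (1 + - 1 * t))
        = beta_density (b - a) a t * exp (x * t) * exp (- x)" for t
      by (auto simp: beta_density_def indicator_def Beta_commute[of a] exp_add[symmetric] algebra_simps mult_exp_exp)
    moreover have "has_bochner_integral lborel (\<lambda>t. beta_density a (b - a) (1 + - 1 * t) * exp (- x * (1 + - 1 * t))) (kummer a b (- x))"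
      using i by (subst (asm) lborel_has_bochner_integral_real_affine_iff[of "- 1" _ _ 1]) auto
    ultimately show ?thesis by (simp add: has_bochner_integral_iff mult.commute)
  qed
  show "kummer a b (- x) = exp (- x) * kummer (b - a) b x" by (rule refl[OF assms])
  show "0 < kummer a b x"
  proof (cases "0 \<le> x")
    case True
    then show ?thesis using assms by (intro kummer_params.kummer_pos_nonneg) (auto simp: kummer_params_def)
  next
    case False
    have "0 < kummer (b - a) b (- x)"
      using assms False by (intro kummer_params.kummer_pos_nonneg) (auto simp: kummer_params_def)
    then show ?thesis using refl[OF assms, of "- x"] by simp
  qed
qed

lemma kummer_moments_beta:
  assumes ab: "0 < \<alpha>" "0 < \<beta>"
  shows "has_bochner_integral (beta_distribution \<alpha> \<beta>) (\<lambda>x. x) (\<alpha> / (\<alpha> + \<beta>))"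
    and "has_bochner_integral (beta_distribution \<alpha> \<beta>) (\<lambda>x. x\<^sup>2) (\<alpha> * (\<alpha> + 1) / ((\<alpha> + \<beta>) * (\<alpha> + \<beta> + 1)))"
  using has_bochner_integral_beta_moment[OF ab, of 1] has_bochner_integral_beta_moment[OF ab, of 2]
  by (auto intro!: has_bochner_integral_beta_distribution[OF ab] simp: numeral_2_eq_2 pochhammer_Suc)

lemma beta_variance_eq:
  assumes ab: "0 < \<alpha>" "0 < \<beta>"
  shows "beta_variance \<alpha> \<beta> = \<alpha> * \<beta> / ((\<alpha> + \<beta>)\<^sup>2 * (\<alpha> + \<beta> + 1))"
proof -
  interpret prob_space "beta_distribution \<alpha> \<beta>" by (rule prob_space_beta_distribution[OF ab])
  note m = kummer_moments_beta[OF ab, unfolded has_bochner_integral_iff]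
  have "beta_variance \<alpha> \<beta> = \<alpha> * (\<alpha> + 1) / ((\<alpha> + \<beta>) * (\<alpha> + \<beta> + 1)) - (\<alpha> / (\<alpha> + \<beta>))\<^sup>2"
    unfolding beta_variance_def using m by (subst variance_eq) auto
  also have "\<dots> = \<alpha> * \<beta> / ((\<alpha> + \<beta>)\<^sup>2 * (\<alpha> + \<beta> + 1))"
  proof -
    have "\<alpha> + \<beta> \<noteq> 0" "\<alpha> + \<beta> + 1 \<noteq> 0" using ab by auto
    then show ?thesis by (simp add: divide_simps) (simp add: algebra_simps power2_eq_square)
  qed
  finally show ?thesis .
qed

text \<open>Centring multiplies the moment generating function by \<open>exp (- l * ?m)\<close>; as
  both sides are positive, the inequality may be taken to logarithms.\<close>

lemma sub_gaussian_beta_iff: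
  assumes ab: "0 < \<alpha>" "0 < \<beta>"
  shows "sub_gaussian (beta_distribution \<alpha> \<beta>) (\<lambda>x. x) v \<longleftrightarrow>
     (\<forall>l. ln (kummer \<alpha> (\<alpha> + \<beta>) l) - l * (\<alpha> / (\<alpha> + \<beta>)) \<le> l\<^sup>2 * v / 2)"
proof -
  interpret prob_space "beta_distribution \<alpha> \<beta>" by (rule prob_space_beta_distribution[OF ab])
  note m = kummer_moments_beta(1)[OF ab, unfolded has_bochner_integral_iff]
  let ?m = "\<alpha> / (\<alpha> + \<beta>)"
  have mgf: "has_bochner_integral (beta_distribution \<alpha> \<beta>) (\<lambda>x. exp (l * (x - ?m)))
      (kummer \<alpha> (\<alpha> + \<beta>) l * exp (- l * ?m))" for l
  proof -
    have "has_bochner_integral (beta_distribution \<alpha> \<beta>) (\<lambda>x. exp (l * x) * exp (- l * ?m))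
      (kummer \<alpha> (\<alpha> + \<beta>) l * exp (- l * ?m))"
      by (intro has_bochner_integral_mult_left has_bochner_integral_beta_distribution[OF ab]
          has_bochner_integral_beta_mgf_lborel[OF ab]) auto
    then show ?thesis by (simp add: exp_add[symmetric] mult_exp_exp algebra_simps)
  qed
  have "kummer \<alpha> (\<alpha> + \<beta>) l * exp (- l * ?m) \<le> exp (l\<^sup>2 * v / 2) \<longleftrightarrow>
      ln (kummer \<alpha> (\<alpha> + \<beta>) l) - l * ?m \<le> l\<^sup>2 * v / 2" for l
  proof -
    have "0 < kummer \<alpha> (\<alpha> + \<beta>) l" using ab by (intro kummer_pos) auto
    then have "kummer \<alpha> (\<alpha> + \<beta>) l * exp (- l * ?m) = exp (ln (kummer \<alpha> (\<alpha> + \<beta>) l) - l * ?m)"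
      by (simp add: exp_diff exp_minus divide_inverse)
    then show ?thesis by (simp only: exp_le_cancel_iff)
  qed
  then show ?thesis
    unfolding sub_gaussian_def using m mgf prob_space_axioms by (simp add: has_bochner_integral_iff)
qed

subsection \<open>The optimal proxy variance\<close>

context kummer_params begin

section \<open>Reflection of the argument and exchange of the parameters\<close>

lemma reflect: "kummer_params (b - a) b"
  using a_pos a_less_b by unfold_locales auto

lemma ln_kummer_uminus: "ln (kummer a b (- x)) = ln (kummer (b - a) b x) - x"
proof -
  have "0 < kummer (b - a) b x" using a_pos a_less_b by (intro kummer_pos) auto
  then show ?thesis using kummer_uminus[OF a_pos a_less_b, of x] by (simp add: ln_mult)
qed

text \<open>Obtained by differentiating both sides of Kummer's transformation.\<close>

lemma u_uminus: "u (- x) = 1 - kummer_params.u (b - a) b x"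
proof -
  interpret r: kummer_params "b - a" b by (rule reflect)
  have "((\<lambda>x. kummer a b (- x)) has_real_derivative - kummer' (- x)) (at x)"
    by (rule DERIV_chain'[OF _ DERIV_kummer, THEN DERIV_cong]) (auto intro!: derivative_eq_intros)
  moreover have "((\<lambda>x. exp (- x) * kummer (b - a) b x) has_real_derivative
      - exp (- x) * kummer (b - a) b x + exp (- x) * r.kummer' x) (at x)"
    by (auto intro!: derivative_eq_intros r.DERIV_kummer)
  ultimately have "- kummer' (- x) = - exp (- x) * kummer (b - a) b x + exp (- x) * r.kummer' x"
    unfolding kummer_uminus[OF a_pos a_less_b] by (rule DERIV_unique)
  then have "kummer' (- x) = exp (- x) * (kummer (b - a) b x - r.kummer' x)"
    by (simp add: algebra_simps)
  moreover have "0 < kummer (b - a) b x" using a_pos a_less_b by (intro kummer_pos) auto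
  ultimately show ?thesis
    by (simp add: u_def r.u_def kummer_uminus[OF a_pos a_less_b] diff_divide_distrib)
qed

text \<open>The linear terms produced by the reflection of \<open>ln (kummer a b x)\<close> and of
  \<open>u\<close> combine with the mean into \<open>1 - a / b\<close>, the mean of the reflected
  distribution.\<close>

lemma G_uminus: "G (- x) = kummer_params.G (b - a) b x"
  using b_pos by (simp add: G_def kummer_params.G_def[OF reflect] u_uminus ln_kummer_uminus
      diff_divide_distrib algebra_simps)

lemma h_uminus: "h (- x) = kummer_params.h (b - a) b x"
  using b_pos by (simp add: h_def kummer_params.h_def[OF reflect] ln_kummer_uminus
      diff_divide_distrib algebra_simps)

section \<open>Translation of the stated notions to \<open>G\<close> and \<open>h\<close>\<close>

lemma beta_x0_equation_iff: "beta_x0_equation a (b - a) x \<longleftrightarrow> G x = 0"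
proof -
  define r where "r = kummer (a + 1) (b + 1) x / kummer a b x"
  have u: "u x = a / b * r" by (simp add: u_def kummer'_def r_def)
  have "a + (b - a) = b" by simp
  then show ?thesis
    unfolding beta_x0_equation_def G_def u r_def[symmetric] using b_pos
    by (simp only: r_def[symmetric]) (auto simp: field_simps)
qed

lemma beta_proxy_formula_eq: "beta_proxy_formula a (b - a) x = (u x - a / b) / x"
proof -
  define r where "r = kummer (a + 1) (b + 1) x / kummer a b x"
  have "u x - a / b = a / b * (r - 1)" by (simp add: u_def kummer'_def r_def right_diff_distrib)
  then show ?thesis by (simp add: beta_proxy_formula_def r_def)
qed

text \<open>Proxy variances are the common upper bounds of \<open>h\<close> on both half-lines, the
  negative one being expressed through the reflected parameters. At \<open>l = 0\<close> the
  inequality is trivial.\<close>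

lemma sub_gaussian_iff:
  "sub_gaussian (beta_distribution a (b - a)) (\<lambda>x. x) v \<longleftrightarrow>
     (\<forall>l>0. h l \<le> v \<and> kummer_params.h (b - a) b l \<le> v)"
proof -
  have *: "ln (kummer a b l) - l * (a / b) \<le> l\<^sup>2 * v / 2 \<longleftrightarrow> l = 0 \<or> h l \<le> v" for l
    by (cases "l = 0") (simp_all add: h_def kummer_0 field_simps)
  have "sub_gaussian (beta_distribution a (b - a)) (\<lambda>x. x) v \<longleftrightarrow>
      (\<forall>l. ln (kummer a b l) - l * (a / b) \<le> l\<^sup>2 * v / 2)"
    using sub_gaussian_beta_iff[of a "b - a" v] a_pos a_less_b by simp
  also have "\<dots> \<longleftrightarrow> (\<forall>l. l = 0 \<or> h l \<le> v)" by (simp only: *)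
  also have "\<dots> \<longleftrightarrow> (\<forall>l>0. h l \<le> v \<and> h (- l) \<le> v)"
  proof (intro iffI allI)
    fix l assume H: "\<forall>l>0. h l \<le> v \<and> h (- l) \<le> v"
    show "l = 0 \<or> h l \<le> v"
      using H[rule_format, of l] H[rule_format, of "- l"] by (cases l "0 :: real" rule: linorder_cases) auto
  qed (metis less_irrefl neg_equal_0_iff_equal)+
  finally show ?thesis by (simp only: h_uminus)
qed

lemma beta_opt_variance_eqI:
  assumes "sub_gaussian (beta_distribution a (b - a)) (\<lambda>x. x) v" and "0 \<le> v"
    and "\<And>w. sub_gaussian (beta_distribution a (b - a)) (\<lambda>x. x) w \<Longrightarrow> v \<le> w"
  shows "beta_opt_variance a (b - a) = v"
  unfolding beta_opt_variance_def optimal_proxy_variance_def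
  using assms by (intro cInf_eq_minimum) auto

lemma sub_gaussian_imp_var0_le:
  assumes "sub_gaussian (beta_distribution a (b - a)) (\<lambda>x. x) v" shows "var0 \<le> v"
proof (rule tendsto_upperbound[OF h_tendsto])
  show "eventually (\<lambda>x. h x \<le> v) (at_right 0)"
    using assms unfolding sub_gaussian_iff by (auto simp: eventually_at_filter)
qed simp

lemma beta_variance_eq_var0: "beta_variance a (b - a) = var0"
  using beta_variance_eq[of a "b - a"] a_pos a_less_b by (simp add: var0_def)

lemma var0_reflect: "kummer_params.var0 (b - a) b = var0"
  by (simp add: var0_def kummer_params.var0_def[OF reflect])

lemma var0_pos: "0 < var0"
  using a_pos a_less_b b_pos by (simp add: var0_def)

text \<open>With mean below 1/2 the maximum over positive arguments is at \<open>x0\<close>. The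
  reflected distribution has mean above 1/2, so on the negative side \<open>G\<close> has no zero
  and \<open>h\<close> is at most \<open>var0 < h x0\<close>.\<close>

lemma optimum_skewed:
  assumes ab: "2 * a < b"
  obtains x0 where "0 < x0" "G x0 = 0" "\<And>x. x \<noteq> 0 \<Longrightarrow> G x = 0 \<Longrightarrow> x = x0"
    "beta_opt_variance a (b - a) = h x0" "sub_gaussian (beta_distribution a (b - a)) (\<lambda>x. x) (h x0)"
    "var0 < h x0" "h x0 < 1 / (4 * (b + 1))"
proof -
  interpret r: kummer_params "b - a" b by (rule reflect)
  obtain x0 where x0: "0 < x0" "G x0 = 0" "\<And>x. 0 < x \<Longrightarrow> G x = 0 \<Longrightarrow> x = x0"
    "\<And>x. 0 < x \<Longrightarrow> h x \<le> h x0" "var0 < h x0"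
    using h_unique_maximum[OF ab] by blast
  have ab': "b \<le> 2 * (b - a)" using ab by simp
  have uniq: "x = x0" if "x \<noteq> 0" "G x = 0" for x
  proof (cases "0 < x")
    case False
    then have "r.G (- x) = 0" "0 < - x" using that G_uminus[of "- x"] by auto
    then show ?thesis using r.G_neg[OF ab', of "- x"] by simp
  qed (use x0 that in auto)
  have sg: "sub_gaussian (beta_distribution a (b - a)) (\<lambda>x. x) (h x0)"
    unfolding sub_gaussian_iff using x0(4) order_trans[OF r.h_le_var0[OF ab'] less_imp_le] x0(5)
    by (simp add: var0_reflect)
  have opt: "beta_opt_variance a (b - a) = h x0"
  proof (rule beta_opt_variance_eqI[OF sg])
    show "0 \<le> h x0" using x0(5) var0_pos by simp
    show "h x0 \<le> w" if "sub_gaussian (beta_distribution a (b - a)) (\<lambda>x. x) w" for w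
      using that[unfolded sub_gaussian_iff] x0(1) by blast
  qed
  show thesis by (rule that[OF x0(1,2) uniq opt sg x0(5) h_less_bound[OF x0(1)]])
qed

end

lemma optimum_nonsymmetric:
  fixes \<alpha> \<beta> :: real
  assumes pos: "0 < \<alpha>" "0 < \<beta>" and ne: "\<alpha> \<noteq> \<beta>"
  obtains x0 where "x0 \<noteq> 0" "\<And>x. x \<noteq> 0 \<Longrightarrow> beta_x0_equation \<alpha> \<beta> x \<longleftrightarrow> x = x0"
    "beta_opt_variance \<alpha> \<beta> = beta_proxy_formula \<alpha> \<beta> x0"
    "sub_gaussian (beta_distribution \<alpha> \<beta>) (\<lambda>x. x) (beta_opt_variance \<alpha> \<beta>)"
    "beta_variance \<alpha> \<beta> < beta_opt_variance \<alpha> \<beta>"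
    "beta_opt_variance \<alpha> \<beta> < 1 / (4 * (\<alpha> + \<beta> + 1))"
proof -
  interpret K: kummer_params \<alpha> "\<alpha> + \<beta>" using pos by unfold_locales auto
  interpret R: kummer_params \<beta> "\<alpha> + \<beta>" using pos by unfold_locales auto
  have main: "\<exists>x0. x0 \<noteq> 0 \<and> K.G x0 = 0 \<and> (\<forall>x. x \<noteq> 0 \<longrightarrow> K.G x = 0 \<longrightarrow> x = x0) \<and>
     beta_opt_variance \<alpha> \<beta> = K.h x0 \<and> sub_gaussian (beta_distribution \<alpha> \<beta>) (\<lambda>x. x) (K.h x0) \<and>
     K.var0 < K.h x0 \<and> K.h x0 < 1 / (4 * (\<alpha> + \<beta> + 1))"
  proof (cases "\<alpha> < \<beta>")
    case True
    then have "2 * \<alpha> < \<alpha> + \<beta>" by simp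
    obtain x0 where x0: "0 < x0" "K.G x0 = 0" "\<And>x. x \<noteq> 0 \<Longrightarrow> K.G x = 0 \<Longrightarrow> x = x0"
      "beta_opt_variance \<alpha> \<beta> = K.h x0" "sub_gaussian (beta_distribution \<alpha> \<beta>) (\<lambda>x. x) (K.h x0)"
      "K.var0 < K.h x0" "K.h x0 < 1 / (4 * (\<alpha> + \<beta> + 1))"
      using K.optimum_skewed[OF \<open>2 * \<alpha> < \<alpha> + \<beta>\<close>, unfolded add_diff_cancel_left'] by blast
    then show ?thesis by (intro exI[of _ x0]) auto
  next
    case False
    then have "2 * \<beta> < \<alpha> + \<beta>" using ne by simp
    have eq: "\<alpha> + \<beta> - \<beta> = \<alpha>" by simp
    obtain x0 where x0: "0 < x0" "R.G x0 = 0" "\<And>x. x \<noteq> 0 \<Longrightarrow> R.G x = 0 \<Longrightarrow> x = x0"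
      "beta_opt_variance \<beta> \<alpha> = R.h x0" "sub_gaussian (beta_distribution \<beta> \<alpha>) (\<lambda>x. x) (R.h x0)"
      "R.var0 < R.h x0" "R.h x0 < 1 / (4 * (\<alpha> + \<beta> + 1))"
      using R.optimum_skewed[OF \<open>2 * \<beta> < \<alpha> + \<beta>\<close>, unfolded eq] by blast
    \<comment> \<open>The criterion \<open>sub_gaussian_iff\<close> is symmetric under exchange of
      the parameters.\<close>
    have sg: "sub_gaussian (beta_distribution \<alpha> \<beta>) (\<lambda>x. x) v \<longleftrightarrow> sub_gaussian (beta_distribution \<beta> \<alpha>) (\<lambda>x. x) v" for v
      using K.sub_gaussian_iff[of v] R.sub_gaussian_iff[of v] by auto
    then have "beta_opt_variance \<alpha> \<beta> = beta_opt_variance \<beta> \<alpha>"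
      by (simp add: beta_opt_variance_def optimal_proxy_variance_def)
    moreover have G: "K.G (- x) = R.G x" and h: "K.h (- x) = R.h x" for x
      using K.G_uminus[of x] K.h_uminus[of x] by auto
    moreover have "x = - x0" if "x \<noteq> 0" "K.G x = 0" for x
      using x0(3)[of "- x"] G[of "- x"] that by simp
    moreover have "R.var0 = K.var0" using K.var0_reflect by simp
    \<comment> \<open>Exchanging the parameters reverses the argument, so the solution is the
      negative number \<open>- x0\<close>.\<close>
    ultimately show ?thesis using x0(1,2,4-7) sg[of "R.h x0"] by (intro exI[of _ "- x0"]) simp
  qed
  then obtain x0 where x0: "x0 \<noteq> 0" "K.G x0 = 0" "\<And>x. x \<noteq> 0 \<Longrightarrow> K.G x = 0 \<Longrightarrow> x = x0"
     "beta_opt_variance \<alpha> \<beta> = K.h x0" "sub_gaussian (beta_distribution \<alpha> \<beta>) (\<lambda>x. x) (K.h x0)"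
     "K.var0 < K.h x0" "K.h x0 < 1 / (4 * (\<alpha> + \<beta> + 1))" by blast
  show thesis
  proof (rule that[OF x0(1)])
    show "beta_x0_equation \<alpha> \<beta> x \<longleftrightarrow> x = x0" if "x \<noteq> 0" for x
    proof -
      have e: "beta_x0_equation \<alpha> \<beta> x \<longleftrightarrow> K.G x = 0"
        using K.beta_x0_equation_iff[of x] by (simp only: add_diff_cancel_left')
      show ?thesis unfolding e using x0(2) x0(3)[OF that] by blast
    qed
    show "beta_opt_variance \<alpha> \<beta> = beta_proxy_formula \<alpha> \<beta> x0"
      using K.beta_proxy_formula_eq[of x0] K.h_at_zero_G[OF x0(1,2)] x0(4) by simp
    show "beta_variance \<alpha> \<beta> < beta_opt_variance \<alpha> \<beta>"
      using K.beta_variance_eq_var0 x0(4,6) by simp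
  qed (use x0(4-7) in simp_all)
qed

text \<open>The mean is 1/2 on both sides of the reflection, so \<open>G\<close> is negative away
  from 0 and \<open>h\<close> is bounded by its limit at 0, the variance. Every proxy variance is at
  least that limit.\<close>

lemma optimum_symmetric:
  fixes \<alpha> :: real
  assumes pos: "0 < \<alpha>"
  shows "beta_x0_equation \<alpha> \<alpha> x \<longleftrightarrow> x = 0"
    and "(beta_proxy_formula \<alpha> \<alpha> \<longlongrightarrow> beta_opt_variance \<alpha> \<alpha>) (at 0)"
    and "sub_gaussian (beta_distribution \<alpha> \<alpha>) (\<lambda>x. x) (beta_opt_variance \<alpha> \<alpha>)"
    and "beta_variance \<alpha> \<alpha> = beta_opt_variance \<alpha> \<alpha>"
    and "beta_opt_variance \<alpha> \<alpha> = 1 / (4 * (2 * \<alpha> + 1))"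
proof -
  interpret K: kummer_params \<alpha> "\<alpha> + \<alpha>" using pos by unfold_locales auto
  have ab: "\<alpha> + \<alpha> \<le> 2 * \<alpha>" by simp
  have sg: "sub_gaussian (beta_distribution \<alpha> \<alpha>) (\<lambda>x. x) K.var0"
    using K.sub_gaussian_iff[of K.var0] K.h_le_var0[OF ab] by simp
  have opt: "beta_opt_variance \<alpha> \<alpha> = K.var0"
    using K.beta_opt_variance_eqI[of K.var0] sg K.var0_pos K.sub_gaussian_imp_var0_le by simp
  show "sub_gaussian (beta_distribution \<alpha> \<alpha>) (\<lambda>x. x) (beta_opt_variance \<alpha> \<alpha>)" using sg opt by simp
  show "beta_variance \<alpha> \<alpha> = beta_opt_variance \<alpha> \<alpha>" using K.beta_variance_eq_var0 opt by simp
  show "beta_opt_variance \<alpha> \<alpha> = 1 / (4 * (2 * \<alpha> + 1))"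
    unfolding opt K.var0_def using pos by (simp add: divide_simps) (simp add: algebra_simps power2_eq_square)
  show "(beta_proxy_formula \<alpha> \<alpha> \<longlongrightarrow> beta_opt_variance \<alpha> \<alpha>) (at 0)"
  proof -
    have "beta_proxy_formula \<alpha> \<alpha> = (\<lambda>x. (K.u x - \<alpha> / (\<alpha> + \<alpha>)) / x)"
      using K.beta_proxy_formula_eq by (simp add: fun_eq_iff)
    then show ?thesis using K.u_slope_tendsto opt by simp
  qed
  show "beta_x0_equation \<alpha> \<alpha> x \<longleftrightarrow> x = 0"
  proof -
    have "K.G x < 0" if "x \<noteq> 0"
      using K.G_neg[OF ab, of x] K.G_neg[OF ab, of "- x"] K.G_uminus[of "- x"] that
      by (cases "0 < x") auto
    moreover have "beta_x0_equation \<alpha> \<alpha> x \<longleftrightarrow> K.G x = 0"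
      using K.beta_x0_equation_iff[of x] by (simp only: add_diff_cancel_left')
    ultimately show ?thesis using K.G_0 by (cases "x = 0") (simp_all only:, fastforce)
  qed
qed

text \<open>The first conjunct says that the infimum is attained. As 0 always solves the equation,
  uniqueness concerns nonzero solutions; for equal parameters there are none, and the formula is
  read as its limit at 0.\<close>

theorem theorem1:
  fixes \<alpha> \<beta> :: real
  assumes "\<alpha> > 0" and "\<beta> > 0"
  shows
    "sub_gaussian (beta_distribution \<alpha> \<beta>) (\<lambda>x. x) (beta_opt_variance \<alpha> \<beta>) \<and>
     (\<alpha> \<noteq> \<beta> \<longrightarrow>
        (\<exists>!x0. x0 \<noteq> 0 \<and> beta_x0_equation \<alpha> \<beta> x0) \<and>
        (\<forall>x0. x0 \<noteq> 0 \<and> beta_x0_equation \<alpha> \<beta> x0 \<longrightarrow>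
              beta_opt_variance \<alpha> \<beta> = beta_proxy_formula \<alpha> \<beta> x0)) \<and>
     (\<alpha> = \<beta> \<longrightarrow>
        (\<forall>x0. beta_x0_equation \<alpha> \<beta> x0 \<longleftrightarrow> x0 = 0) \<and>
        (beta_proxy_formula \<alpha> \<beta> \<longlongrightarrow> beta_opt_variance \<alpha> \<beta>) (at 0)) \<and>
     beta_opt_variance \<alpha> \<beta> \<le> 1 / (4 * (\<alpha> + \<beta> + 1)) \<and>
     (\<alpha> \<noteq> \<beta> \<longrightarrow>
        beta_variance \<alpha> \<beta> < beta_opt_variance \<alpha> \<beta> \<and>
        beta_opt_variance \<alpha> \<beta> < 1 / (4 * (\<alpha> + \<beta> + 1))) \<and>
     (\<alpha> = \<beta> \<longrightarrow>
        beta_variance \<alpha> \<alpha> = beta_opt_variance \<alpha> \<alpha> \<and>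
        beta_opt_variance \<alpha> \<alpha> = 1 / (4 * (2 * \<alpha> + 1)))"
proof (cases "\<alpha> = \<beta>")
  case True
  then show ?thesis using optimum_symmetric[OF assms(1)] by simp
next
  case False
  obtain x0 where x0: "x0 \<noteq> 0" "\<And>x. x \<noteq> 0 \<Longrightarrow> beta_x0_equation \<alpha> \<beta> x \<longleftrightarrow> x = x0"
    and rest: "beta_opt_variance \<alpha> \<beta> = beta_proxy_formula \<alpha> \<beta> x0"
    "sub_gaussian (beta_distribution \<alpha> \<beta>) (\<lambda>x. x) (beta_opt_variance \<alpha> \<beta>)"
    "beta_variance \<alpha> \<beta> < beta_opt_variance \<alpha> \<beta>"
    "beta_opt_variance \<alpha> \<beta> < 1 / (4 * (\<alpha> + \<beta> + 1))"
    using optimum_nonsymmetric[OF assms False] by blast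
  have "\<exists>!x0. x0 \<noteq> 0 \<and> beta_x0_equation \<alpha> \<beta> x0" using x0 by blast
  moreover have "beta_opt_variance \<alpha> \<beta> = beta_proxy_formula \<alpha> \<beta> x"
    if "x \<noteq> 0" "beta_x0_equation \<alpha> \<beta> x" for x
    using x0(2)[OF that(1)] that(2) rest(1) by simp
  ultimately show ?thesis using rest False by auto
qed

end
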